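(* Let $n\ge 2$, let $G$ be a finite group acting on a finite set $S$ with $|S|\ge1$, and let $T\subseteq S$ be a $G$-invariant subset such that $G$ acts trivially on $S\setminus T$. Then the poset $\mathcal{P}_n(G,S,T)\cup\{\hat 1\}$, obtained by adjoining a new top element $\hat 1$, is EL-shellable.
   Context: Let $[n]=\{1,\dots,n\}$. A partial $G$-partition of $[n]$ is a set $\tilde\beta=\{\tilde B_1,\dots,\tilde B_\ell\}$ where $\{B_1,\dots,B_\ell\}$ is a partition of a subset $\bigcup B_i\subseteq[n]$ into nonempty blocks, and each $\tilde B_i$ consists of $B_i$ with a function $b_i\colon B_i\to G$ up to $b_i\sim b_ig$ ($g\in G$). The zero block is $Z=[n]\setminus\bigcup B_i$. The $S$-Dowling poset $\mathcal{D}_n(G,S)$ is the set of pairs $(\tilde\beta,z)$, $z\colon Z\to S$, ordered by the relation generated by: (merge) $(\tilde\beta\cup\{\tilde A,\tilde B\},z)\prec(\tilde\beta\cup\{\tilde C\},z)$ with $C=A\cup B$, $c|_A=a$, $c|_B=b\cdot g$ for some $g\in G$; (color) $(\tilde\beta\cup\{\tilde B\},z)\prec(\tilde\beta,z')$ with $z'$ extending $z$ to $Z\cup B$ and $z'(i)=b(i)\cdot s$ for all $i\in B$, some $s\in S$. For a $G$-invariant $T\subseteq S$, $\mathcal{P}_n(G,S,T)=\{(\tilde\beta,z)\in\mathcal{D}_n(G,S): |z^{-1}(O)|\neq 1\text{ for every }G\text{-orbit }O\subseteq S\setminus T\}$ with the induced order. A bounded poset is EL-shellable if there is a labeling of its covering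 pairs by elements of some poset such that every closed interval $[x,y]$ has a unique maximal chain with strictly increasing label word, and this word lexicographically precedes those of all other maximal chains of $[x,y]$. *)

theory Defs
  imports "HOL-Algebra.Group_Action" "HOL-Library.Disjoint_Sets"
begin

section \<open>Posets and EL-shellability\<close>

text \<open>A poset is given by its reflexive order relation \<open>r\<close>; its ground set is \<open>Field r\<close>.\<close>

definition bounded_poset :: "'a rel \<Rightarrow> bool" where
  "bounded_poset r \<longleftrightarrow> Partial_order r \<and>
     (\<exists>b\<in>Field r. \<forall>x\<in>Field r. (b, x) \<in> r) \<and>
     (\<exists>t\<in>Field r. \<forall>x\<in>Field r. (x, t) \<in> r)"

definition covers :: "'a rel \<Rightarrow> 'a \<Rightarrow> 'a \<Rightarrow> bool" where
  "covers r x y \<longleftrightarrow> (x, y) \<in> r - Id \<and> \<not> (\<exists>w. (x, w) \<in> r - Id \<and> (w, y) \<in> r - Id)"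

definition closed_interval :: "'a rel \<Rightarrow> 'a \<Rightarrow> 'a \<Rightarrow> 'a set" where
  "closed_interval r x y = {w. (x, w) \<in> r \<and> (w, y) \<in> r}"

definition strictly_increasing :: "'a rel \<Rightarrow> 'a list \<Rightarrow> bool" where
  "strictly_increasing r xs \<longleftrightarrow> sorted_wrt (\<lambda>a b. (a, b) \<in> r - Id) xs"

text \<open>Finite chains are listed in increasing order; maximality is with respect to inclusion.\<close>

definition maximal_chain :: "'a rel \<Rightarrow> 'a \<Rightarrow> 'a \<Rightarrow> 'a list \<Rightarrow> bool" where
  "maximal_chain r x y xs \<longleftrightarrow>
     strictly_increasing r xs \<and> set xs \<subseteq> closed_interval r x y \<and>
     (\<forall>ys. strictly_increasing r ys \<and> set ys \<subseteq> closed_interval r x y \<and> set xs \<subseteq> set ys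
        \<longrightarrow> set ys = set xs)"

definition label_word :: "('a \<times> 'a \<Rightarrow> 'l) \<Rightarrow> 'a list \<Rightarrow> 'l list" where
  "label_word lam xs = map lam (zip xs (tl xs))"

definition EL_labeling :: "'a rel \<Rightarrow> 'l rel \<Rightarrow> ('a \<times> 'a \<Rightarrow> 'l) \<Rightarrow> bool" where
  "EL_labeling r L lam \<longleftrightarrow>
     Partial_order L \<and>
     (\<forall>x y. covers r x y \<longrightarrow> lam (x, y) \<in> Field L) \<and>
     (\<forall>(x, y)\<in>r. \<exists>xs. maximal_chain r x y xs \<and> strictly_increasing L (label_word lam xs) \<and>
        (\<forall>ys. maximal_chain r x y ys \<and> ys \<noteq> xs \<longrightarrow>
           \<not> strictly_increasing L (label_word lam ys) \<and>
           (label_word lam xs, label_word lam ys) \<in> lexord (L - Id)))"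

text \<open>
  HOL cannot quantify existentially over the type of labels. Taking labels of type \<open>'a \<times> 'a\<close>
  is no restriction: the labels in use are no more numerous than the covering pairs. The lemma
  \<open>EL_shellableI\<close> below derives \<open>EL_shellable\<close> from an EL-labeling by a poset over any type.
\<close>

definition EL_shellable :: "'a rel \<Rightarrow> bool" where
  "EL_shellable r \<longleftrightarrow>
     bounded_poset r \<and> (\<exists>(L :: ('a \<times> 'a) rel) (lam :: 'a \<times> 'a \<Rightarrow> 'a \<times> 'a). EL_labeling r L lam)"

definition adjoin_top :: "'a rel \<Rightarrow> 'a option rel" where
  "adjoin_top r = {(Some x, Some y) | x y. (x, y) \<in> r} \<union> insert None (Some ` Field r) \<times> {None}"

lemma maximal_chain_iff_saturated:
  assumes po: "Partial_order r" and xy: "(x, y) \<in> r"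
  shows "maximal_chain r x y xs \<longleftrightarrow>
           xs \<noteq> [] \<and> hd xs = x \<and> last xs = y \<and> successively (covers r) xs"
proof -
  have tr: "trans r" and an: "antisym r" and rf: "refl_on (Field r) r"
    using po by (auto simp: order_on_defs)
  have rxx: "(x, x) \<in> r" and ryy: "(y, y) \<in> r"
    using rf xy by (auto simp: refl_on_def Field_def)
  note T = transD[OF tr] and A = antisymD[OF an]
  have TS: "(a, c) \<in> r - Id" if "(a, b) \<in> r - Id" "(b, c) \<in> r - Id" for a b c
    using transD[OF trans_diff_Id[OF tr an] that] .
  have tp: "transp (\<lambda>a b. (a, b) \<in> r - Id)"
    using TS by (rule transpI)
  show ?thesis
  proof
    assume m: "maximal_chain r x y xs"
    then have inc: "sorted_wrt (\<lambda>a b. (a, b) \<in> r - Id) xs"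
      and sub: "set xs \<subseteq> closed_interval r x y"
      and mx: "\<And>ys. \<lbrakk>sorted_wrt (\<lambda>a b. (a, b) \<in> r - Id) ys; set ys \<subseteq> closed_interval r x y;
                set xs \<subseteq> set ys\<rbrakk> \<Longrightarrow> set ys = set xs"
      by (auto simp: maximal_chain_def strictly_increasing_def)
    have x_in: "x \<in> set xs"
    proof (rule ccontr)
      assume n: "x \<notin> set xs"
      have "set (x # xs) = set xs"
        by (rule mx) (use n inc sub rxx xy in \<open>auto simp: closed_interval_def\<close>)
      with n show False by auto
    qed
    have y_in: "y \<in> set xs"
    proof (rule ccontr)
      assume n: "y \<notin> set xs"
      have "set (xs @ [y]) = set xs"
        by (rule mx) (use n inc sub ryy xy in \<open>auto simp: closed_interval_def sorted_wrt_append\<close>)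
      with n show False by auto
    qed
    have ne: "xs \<noteq> []" using x_in by auto
    have h: "hd xs = x"
    proof (cases xs)
      case (Cons a as)
      then show ?thesis using inc sub x_in by (auto simp: closed_interval_def dest: A)
    qed (use ne in simp)
    have l: "last xs = y"
    proof (cases xs rule: rev_cases)
      case (snoc as a)
      then show ?thesis using inc sub y_in
        by (auto simp: closed_interval_def sorted_wrt_append dest: A)
    qed (use ne in simp)
    have "covers r (xs ! i) (xs ! Suc i)" if i: "Suc i < length xs" for i
    proof -
      define us a b vs where d: "us = take i xs" "a = xs ! i" "b = xs ! Suc i"
        "vs = drop (Suc (Suc i)) xs"
      have e: "xs = us @ a # b # vs"
        unfolding d using i by (metis Cons_nth_drop_Suc Suc_lessD append_take_drop_id)
      have ab: "(a, b) \<in> r - Id" using inc unfolding e by (simp add: sorted_wrt_append)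
      have "\<not> (\<exists>w. (a, w) \<in> r - Id \<and> (w, b) \<in> r - Id)"
      proof
        assume "\<exists>w. (a, w) \<in> r - Id \<and> (w, b) \<in> r - Id"
        then obtain w where w: "(a, w) \<in> r - Id" "(w, b) \<in> r - Id" by blast
        have s: "sorted_wrt (\<lambda>a b. (a, b) \<in> r - Id) (us @ a # w # b # vs)"
        proof -
          have "\<forall>u\<in>set us. (u, a) \<in> r - Id" "\<forall>v\<in>set vs. (b, v) \<in> r - Id"
            using inc unfolding e by (simp_all add: sorted_wrt_append)
          then have "\<forall>u\<in>set us. (u, w) \<in> r - Id" "\<forall>v\<in>set vs. (w, v) \<in> r - Id"
            using TS w by blast+
          then show ?thesis using inc w unfolding e by (simp add: sorted_wrt_append)
        qed
        have "set (us @ a # w # b # vs) = set xs"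
        proof (rule mx[OF s])
          have "(x, a) \<in> r" "(b, y) \<in> r" using sub by (auto simp: e closed_interval_def)
          then have "w \<in> closed_interval r x y"
            using w T[of x a w] T[of w b y] by (simp add: closed_interval_def)
          then show "set (us @ a # w # b # vs) \<subseteq> closed_interval r x y" using sub e by auto
        qed (auto simp: e)
        then have "w \<in> set us \<or> w = a \<or> w = b \<or> w \<in> set vs" unfolding e by auto
        with s show False by (auto simp: sorted_wrt_append)
      qed
      with ab show ?thesis by (simp add: covers_def d)
    qed
    then have "successively (covers r) xs" by (simp add: successively_conv_nth)
    with ne h l show "xs \<noteq> [] \<and> hd xs = x \<and> last xs = y \<and> successively (covers r) xs" by simp
  next
    assume a: "xs \<noteq> [] \<and> hd xs = x \<and> last xs = y \<and> successively (covers r) xs"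
    have "successively (\<lambda>a b. (a, b) \<in> r - Id) xs"
      by (rule successively_mono[where P = "covers r"]) (use a in \<open>auto simp: covers_def\<close>)
    then have inc: "sorted_wrt (\<lambda>a b. (a, b) \<in> r - Id) xs"
      using successively_conv_sorted_wrt[OF tp] by blast
    have sub: "set xs \<subseteq> closed_interval r x y"
    proof
      fix w assume w: "w \<in> set xs"
      have "(x, w) \<in> r" using a inc w rxx by (cases xs) auto
      moreover have "(w, y) \<in> r" using a inc w ryy
        by (cases xs rule: rev_cases) (auto simp: sorted_wrt_append)
      ultimately show "w \<in> closed_interval r x y" by (simp add: closed_interval_def)
    qed
    have key: "w \<in> set zs"
      if "zs \<noteq> []" "successively (covers r) zs" "(hd zs, w) \<in> r" "(w, last zs) \<in> r"
        "\<forall>v\<in>set zs. (v, w) \<in> r \<or> (w, v) \<in> r" for w zs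
      using that
    proof (induction zs)
      case (Cons u us)
      show ?case
      proof (cases us)
        case Nil
        then show ?thesis using Cons.prems by (auto dest: A)
      next
        case (Cons v vs)
        show ?thesis
        proof (cases "(v, w) \<in> r")
          case True
          then have "w \<in> set us" using Cons Cons.prems by (intro Cons.IH) auto
          then show ?thesis by simp
        next
          case False
          then have "(w, v) \<in> r" "v \<noteq> w" using Cons Cons.prems rf
            by (auto simp: refl_on_def Field_def)
          moreover have "covers r u v" using Cons Cons.prems by simp
          ultimately have "w = u" using Cons.prems(3) unfolding covers_def by auto
          then show ?thesis by simp
        qed
      qed
    qed simp
    show "maximal_chain r x y xs"
      unfolding maximal_chain_def strictly_increasing_def
    proof (intro conjI allI impI inc sub)
      fix ys
      assume ys: "sorted_wrt (\<lambda>a b. (a, b) \<in> r - Id) ys \<and> set ys \<subseteq> closed_interval r x y \<and>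
        set xs \<subseteq> set ys"
      have "w \<in> set xs" if w: "w \<in> set ys" for w
      proof (rule key)
        have wr: "(w, w) \<in> r" using w ys rf
          by (auto simp: closed_interval_def refl_on_def Field_def)
        show "\<forall>v\<in>set xs. (v, w) \<in> r \<or> (w, v) \<in> r"
        proof
          fix v assume "v \<in> set xs"
          then have "v \<in> set ys" using ys by auto
          then obtain i j where ij: "i < length ys" "j < length ys" "v = ys ! i" "w = ys ! j"
            using w by (metis in_set_conv_nth)
          consider "i < j" | "i = j" | "j < i" by linarith
          then show "(v, w) \<in> r \<or> (w, v) \<in> r"
          proof cases
            case 1
            then show ?thesis using ys ij sorted_wrt_nth_less by fastforce
          next
            case 2
            then show ?thesis using ij wr by simp
          next
            case 3
            then show ?thesis using ys ij sorted_wrt_nth_less by fastforce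
          qed
        qed
      qed (use a ys w in \<open>auto simp: closed_interval_def\<close>)
      then show "set ys = set xs" using ys by auto
    qed
  qed
qed

lemma EL_shellableI:
  fixes r :: "'a rel" and L :: "'l rel"
  assumes bd: "bounded_poset r" and el: "EL_labeling r L lam"
  shows "EL_shellable r"
proof -
  define E where "E = {(x, y). covers r x y}"
  define rep where "rep l = (SOME e. e \<in> E \<and> lam e = l)" for l
  define F where "F = lam ` E"
  define L' where "L' = {(rep k, rep l) | k l. k \<in> F \<and> l \<in> F \<and> (k, l) \<in> L}"
  define lam' where "lam' = rep \<circ> lam"
  have po: "Partial_order r" using bd by (simp add: bounded_poset_def)
  have poL: "Partial_order L" and FL: "F \<subseteq> Field L"
    using el by (auto simp: EL_labeling_def F_def E_def)
  have lr: "lam (rep l) = l" if "l \<in> F" for l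
  proof -
    have "\<exists>e. e \<in> E \<and> lam e = l" using that by (auto simp: F_def)
    from someI_ex[OF this] show ?thesis by (simp add: rep_def)
  qed
  have L'_iff: "(rep k, rep l) \<in> L' \<longleftrightarrow> (k, l) \<in> L" if "k \<in> F" "l \<in> F" for k l
  proof
    assume "(rep k, rep l) \<in> L'"
    then obtain k' l' where *: "rep k = rep k'" "rep l = rep l'" "k' \<in> F" "l' \<in> F" "(k', l') \<in> L"
      by (auto simp: L'_def)
    then have "k' = k" "l' = l" using lr that by metis+
    with * show "(k, l) \<in> L" by simp
  qed (use that in \<open>auto simp: L'_def\<close>)
  have rep_eq: "rep k = rep l \<longleftrightarrow> k = l" if "k \<in> F" "l \<in> F" for k l
    using that lr by metis
  have S_iff: "(rep k, rep l) \<in> L' - Id \<longleftrightarrow> (k, l) \<in> L - Id" if "k \<in> F" "l \<in> F" for k l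
    using L'_iff[OF that] rep_eq[OF that] by simp
  have reflL: "(k, k) \<in> L" if "k \<in> F" for k
    using that FL poL by (auto simp: order_on_defs refl_on_def)
  have FieldL': "Field L' = rep ` F"
    using reflL by (fastforce simp: L'_def Field_def)
  have poL': "Partial_order L'"
    unfolding order_on_defs FieldL'
  proof (intro conjI)
    show "L' \<subseteq> rep ` F \<times> rep ` F" by (auto simp: L'_def)
    show "refl_on (rep ` F) L'" using reflL by (auto simp: refl_on_def L'_iff)
    show "trans L'"
    proof (rule transI)
      fix a b c assume "(a, b) \<in> L'" "(b, c) \<in> L'"
      then obtain k l l' m where *: "a = rep k" "b = rep l" "b = rep l'" "c = rep m"
        "k \<in> F" "l \<in> F" "l' \<in> F" "m \<in> F" "(k, l) \<in> L" "(l', m) \<in> L"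
        by (auto simp: L'_def)
      then have "l' = l" using rep_eq by metis
      then have "(k, m) \<in> L" using * poL by (meson order_on_defs(1,2) transD)
      then show "(a, c) \<in> L'" using * by (simp add: L'_iff)
    qed
    show "antisym L'"
    proof (rule antisymI)
      fix a b assume ab: "(a, b) \<in> L'" "(b, a) \<in> L'"
      then obtain k l where *: "a = rep k" "b = rep l" "k \<in> F" "l \<in> F" by (auto simp: L'_def)
      then have "(k, l) \<in> L" "(l, k) \<in> L" using ab by (auto simp: L'_iff)
      then have "k = l" using poL unfolding order_on_defs by (blast dest: antisymD)
      then show "a = b" using * by simp
    qed
  qed
  have word': "label_word lam' xs = map rep (label_word lam xs)" for xs
    by (simp add: label_word_def lam'_def)
  have inF: "set (label_word lam xs) \<subseteq> F" if "maximal_chain r x y xs" "(x, y) \<in> r" for x y xs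
  proof -
    have "successively (covers r) xs"
      using that maximal_chain_iff_saturated[OF po] by blast
    then have "set (zip xs (tl xs)) \<subseteq> E"
      by (auto simp: E_def successively_conv_nth set_zip nth_tl)
    then show ?thesis by (auto simp: label_word_def F_def)
  qed
  have inc: "strictly_increasing L' (map rep v) \<longleftrightarrow> strictly_increasing L v"
    if "set v \<subseteq> F" for v
    using that
  proof (induction v)
    case (Cons k v)
    then have "(\<forall>l\<in>set v. (rep k, rep l) \<in> L' - Id) \<longleftrightarrow> (\<forall>l\<in>set v. (k, l) \<in> L - Id)"
      by (intro ball_cong refl S_iff) auto
    with Cons show ?case by (simp add: strictly_increasing_def)
  qed (simp add: strictly_increasing_def)
  have lex: "(map rep v, map rep w) \<in> lexord (L' - Id) \<longleftrightarrow> (v, w) \<in> lexord (L - Id)"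
    if "set v \<subseteq> F" "set w \<subseteq> F" for v w
    using that
  proof (induction v arbitrary: w)
    case Nil
    then show ?case by (cases w) auto
  next
    case (Cons k v)
    then show ?case
    proof (cases w)
      case (Cons l w')
      with Cons.prems Cons.IH[of w'] S_iff[of k l] rep_eq[of k l] show ?thesis by simp
    qed simp
  qed
  have "EL_labeling r L' lam'"
    unfolding EL_labeling_def
  proof (intro conjI poL' allI impI)
    show "lam' (x, y) \<in> Field L'" if "covers r x y" for x y
      using that by (auto simp: FieldL' lam'_def F_def E_def)
    show "\<forall>(x, y)\<in>r. \<exists>xs. maximal_chain r x y xs \<and> strictly_increasing L' (label_word lam' xs) \<and>
        (\<forall>ys. maximal_chain r x y ys \<and> ys \<noteq> xs \<longrightarrow>
           \<not> strictly_increasing L' (label_word lam' ys) \<and>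
           (label_word lam' xs, label_word lam' ys) \<in> lexord (L' - Id))"
    proof clarify
      fix x y assume xy: "(x, y) \<in> r"
      with el obtain xs where xs: "maximal_chain r x y xs"
        "strictly_increasing L (label_word lam xs)"
        "\<And>ys. maximal_chain r x y ys \<Longrightarrow> ys \<noteq> xs \<Longrightarrow>
           \<not> strictly_increasing L (label_word lam ys) \<and>
           (label_word lam xs, label_word lam ys) \<in> lexord (L - Id)"
        unfolding EL_labeling_def by blast
      show "\<exists>xs. maximal_chain r x y xs \<and> strictly_increasing L' (label_word lam' xs) \<and>
        (\<forall>ys. maximal_chain r x y ys \<and> ys \<noteq> xs \<longrightarrow>
           \<not> strictly_increasing L' (label_word lam' ys) \<and>
           (label_word lam' xs, label_word lam' ys) \<in> lexord (L' - Id))"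
      proof (intro exI[of _ xs] conjI allI impI; (elim conjE)?)
        show "maximal_chain r x y xs" by (rule xs(1))
        show "strictly_increasing L' (label_word lam' xs)"
          unfolding word' inc[OF inF[OF xs(1) xy]] by (rule xs(2))
        fix ys assume ys: "maximal_chain r x y ys" "ys \<noteq> xs"
        show "\<not> strictly_increasing L' (label_word lam' ys)"
          unfolding word' inc[OF inF[OF ys(1) xy]] using xs(3)[OF ys] by blast
        show "(label_word lam' xs, label_word lam' ys) \<in> lexord (L' - Id)"
          unfolding word' lex[OF inF[OF xs(1) xy] inF[OF ys(1) xy]] using xs(3)[OF ys] by blast
      qed
    qed
  qed
  with bd show ?thesis unfolding EL_shellable_def by blast
qed

section \<open>Dowling posets\<close>

text \<open>
  A function \<open>b : B \<rightarrow> G\<close> is an element of \<open>B \<rightarrow>\<^sub>E carrier G\<close>. The underlying set \<open>B\<close> is kept as a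
  separate component of a block because it cannot be read off from \<open>b\<close> when \<open>undefined\<close> happens
  to lie in \<open>carrier G\<close>.
\<close>

type_synonym 'g gblock = "nat set \<times> (nat \<Rightarrow> 'g) set"

type_synonym ('g, 's) dowling_elt = "'g gblock set \<times> (nat \<Rightarrow> 's)"

definition proj_rel :: "('g, 'm) monoid_scheme \<Rightarrow> nat set \<Rightarrow> (nat \<Rightarrow> 'g) rel" where
  "proj_rel G B = {(b, b'). b \<in> B \<rightarrow>\<^sub>E carrier G \<and> b' \<in> B \<rightarrow>\<^sub>E carrier G \<and>
                    (\<exists>g\<in>carrier G. \<forall>i\<in>B. b' i = b i \<otimes>\<^bsub>G\<^esub> g)}"

definition gblock :: "('g, 'm) monoid_scheme \<Rightarrow> nat set \<Rightarrow> (nat \<Rightarrow> 'g) \<Rightarrow> 'g gblock" where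
  "gblock G B b = (B, proj_rel G B `` {b})"

definition partial_G_partitions :: "nat \<Rightarrow> ('g, 'm) monoid_scheme \<Rightarrow> 'g gblock set set" where
  "partial_G_partitions n G = {\<beta>.
     (\<exists>A\<subseteq>{1..n}. partition_on A (fst ` \<beta>)) \<and> inj_on fst \<beta> \<and>
     (\<forall>(B, c)\<in>\<beta>. c \<in> (B \<rightarrow>\<^sub>E carrier G) // proj_rel G B)}"

definition zero_block :: "nat \<Rightarrow> 'g gblock set \<Rightarrow> nat set" where
  "zero_block n \<beta> = {1..n} - \<Union>(fst ` \<beta>)"

definition Dowling :: "nat \<Rightarrow> ('g, 'm) monoid_scheme \<Rightarrow> 's set \<Rightarrow> ('g, 's) dowling_elt set" where
  "Dowling n G S = {(\<beta>, z). \<beta> \<in> partial_G_partitions n G \<and> z \<in> zero_block n \<beta> \<rightarrow>\<^sub>E S}"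

inductive Dowling_step ::
    "nat \<Rightarrow> ('g, 'm) monoid_scheme \<Rightarrow> 's set \<Rightarrow> ('g \<Rightarrow> 's \<Rightarrow> 's) \<Rightarrow>
     ('g, 's) dowling_elt \<Rightarrow> ('g, 's) dowling_elt \<Rightarrow> bool"
  for n G S \<phi> where
  merge:
    "Dowling_step n G S \<phi> (\<beta> \<union> {gblock G A a, gblock G B b}, z) (\<beta> \<union> {gblock G (A \<union> B) c}, z)"
    if "(\<beta> \<union> {gblock G A a, gblock G B b}, z) \<in> Dowling n G S"
      "gblock G A a \<notin> \<beta>" "gblock G B b \<notin> \<beta>" "gblock G A a \<noteq> gblock G B b"
      "a \<in> A \<rightarrow>\<^sub>E carrier G" "b \<in> B \<rightarrow>\<^sub>E carrier G" "c \<in> A \<union> B \<rightarrow>\<^sub>E carrier G"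
      "g \<in> carrier G" "\<forall>i\<in>A. c i = a i" "\<forall>i\<in>B. c i = b i \<otimes>\<^bsub>G\<^esub> g"
| color:
    "Dowling_step n G S \<phi> (\<beta> \<union> {gblock G B b}, z) (\<beta>, z')"
    if "(\<beta> \<union> {gblock G B b}, z) \<in> Dowling n G S"
      "gblock G B b \<notin> \<beta>" "b \<in> B \<rightarrow>\<^sub>E carrier G"
      "z' \<in> zero_block n (\<beta> \<union> {gblock G B b}) \<union> B \<rightarrow>\<^sub>E S"
      "\<forall>i\<in>zero_block n (\<beta> \<union> {gblock G B b}). z' i = z i"
      "s \<in> S" "\<forall>i\<in>B. z' i = \<phi> (b i) s"

definition Dowling_order ::
    "nat \<Rightarrow> ('g, 'm) monoid_scheme \<Rightarrow> 's set \<Rightarrow> ('g \<Rightarrow> 's \<Rightarrow> 's) \<Rightarrow> ('g, 's) dowling_elt rel" where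
  "Dowling_order n G S \<phi> =
     {(p, q). p \<in> Dowling n G S \<and> q \<in> Dowling n G S \<and> (Dowling_step n G S \<phi>)\<^sup>*\<^sup>* p q}"

definition sub_Dowling ::
    "nat \<Rightarrow> ('g, 'm) monoid_scheme \<Rightarrow> 's set \<Rightarrow> 's set \<Rightarrow> ('g \<Rightarrow> 's \<Rightarrow> 's) \<Rightarrow>
     ('g, 's) dowling_elt set" where
  "sub_Dowling n G S T \<phi> = {(\<beta>, z) \<in> Dowling n G S.
     \<forall>X \<in> orbits G S \<phi>. X \<subseteq> S - T \<longrightarrow> card {i \<in> zero_block n \<beta>. z i \<in> X} \<noteq> 1}"

definition sub_Dowling_order ::
    "nat \<Rightarrow> ('g, 'm) monoid_scheme \<Rightarrow> 's set \<Rightarrow> 's set \<Rightarrow> ('g \<Rightarrow> 's \<Rightarrow> 's) \<Rightarrow>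
     ('g, 's) dowling_elt rel" where
  "sub_Dowling_order n G S T \<phi> = Restr (Dowling_order n G S \<phi>) (sub_Dowling n G S T \<phi>)"

end

theory Submission
  imports Defs "HOL-Library.Product_Lexorder"
begin

text \<open>
  A labeling is an EL-labeling as soon as every interval \<open>[x, y]\<close> has an atom \<open>u\<close> of strictly smallest
  label such that all steps after \<open>u\<close> inside \<open>[x, y]\<close> have larger labels, while every other atom \<open>w\<close> can
  be continued inside \<open>[x, y]\<close> by a step whose label does not exceed that of \<open>x \<prec> w\<close>.

  Normalize each block so that its function is \<open>1\<close> at the minimum of the block. A step absorbs one block,
  with minimum \<open>d\<close>, either into a block with smaller minimum \<open>e\<close>, via a group element \<open>g\<close>, or into the zero
  block, where \<open>d\<close> receives a colour \<open>s\<close>. Label it \<open>(0, d)\<close> in the first case with \<open>g = 1\<close>, \<open>(1, idx s)\<close> in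
  the second case, and \<open>(2, q)\<close> in the first case with \<open>g \<noteq> 1\<close>, where \<open>q\<close> is the least element of the new
  block having the same value as \<open>d\<close>. Steps to the adjoined top get \<open>(1, 1)\<close>. In \<open>[x, y]\<close> the rising
  chain first merges with \<open>g = 1\<close> all blocks whose minima have equal value or colour in \<open>y\<close>, then colours
  the resulting blocks in the order of \<open>idx\<close>, and then performs the remaining merges. All blocks of a
  colour outside \<open>T\<close> are thus coloured at once, so the size condition is never violated on the way.
\<close>

section \<open>A local criterion for EL-labelings\<close>

text \<open>The third kind of label answers an obstacle. Take the blocks {1}, {2}, {3} and let 2 and
  3 both have the value \<open>g \<cdot> 1\<close> in \<open>y\<close>, with \<open>g\<close> not
  the identity. Merging 3 into 2 and then 2 into 1 has the labels (0, 3), (2, 2). If a merge with a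
  nontrivial factor were labelled by the absorbed minimum, then 2 into 1 followed by 3 into 1 would
  have the labels (2, 2), (2, 3) and rise as well. The least element of equal value turns that last
  label into (2, 2). The other obstacle is that a colouring may leave the poset. Because the action
  is trivial outside \<open>T\<close>, this happens only if a singleton block receives a colour
  outside \<open>T\<close> that did not occur before. After a rival step the intended step is mostly
  still possible. The cases that need an argument are those where the rival has absorbed one of the
  two roots concerned; then a step on the partner or on the receiving block costs no more than the
  rival did.\<close>

locale local_EL =
  fixes r :: "'a rel" and E :: "'a \<Rightarrow> 'a \<Rightarrow> bool" and rk :: "'a \<Rightarrow> nat"
    and lab :: "'a \<times> 'a \<Rightarrow> 'l::linorder"
  assumes po: "Partial_order r"
    and E_r: "E x y \<Longrightarrow> (x, y) \<in> r"
    and E_rk: "E x y \<Longrightarrow> rk y = Suc (rk x)"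
    and r_rk: "(x, y) \<in> r \<Longrightarrow> x \<noteq> y \<Longrightarrow> rk x < rk y"
    and first_step: "(x, y) \<in> r \<Longrightarrow> x \<noteq> y \<Longrightarrow>
      \<exists>u. E x u \<and> (u, y) \<in> r \<and>
        (\<forall>w. E x w \<and> (w, y) \<in> r \<and> w \<noteq> u \<longrightarrow>
           lab (x, u) < lab (x, w) \<and> (\<exists>v. E w v \<and> (v, y) \<in> r \<and> lab (w, v) \<le> lab (x, w))) \<and>
        (\<forall>v. E u v \<and> (v, y) \<in> r \<longrightarrow> lab (x, u) < lab (u, v))"
begin

text \<open>A step of \<open>E\<close> raises \<open>rk\<close> by exactly one, which leaves no room
  for an element in between. Conversely, the step that \<open>first_step\<close> supplies in
  \<open>[x, y]\<close> must already end at \<open>y\<close> if \<open>y\<close> covers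
  \<open>x\<close>.\<close>

lemma covers_iff: "covers r x y \<longleftrightarrow> E x y"
proof
  assume c: "covers r x y"
  then have "(x, y) \<in> r" "x \<noteq> y" by (auto simp: covers_def)
  from first_step[OF this] obtain u where u: "E x u" "(u, y) \<in> r" by blast
  have "(x, u) \<in> r - Id" using u E_r E_rk by (metis DiffI n_not_Suc_n pair_in_Id_conv)
  then have "u = y" using c u by (auto simp: covers_def)
  then show "E x y" using u by simp
next
  assume e: "E x y"
  have "(x, y) \<in> r - Id" using e E_r E_rk by (metis DiffI n_not_Suc_n pair_in_Id_conv)
  moreover have False if "(x, w) \<in> r - Id" "(w, y) \<in> r - Id" for w
    using r_rk[of x w] r_rk[of w y] E_rk[OF e] that by auto
  ultimately show "covers r x y" by (auto simp: covers_def)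
qed

definition saturated :: "'a \<Rightarrow> 'a \<Rightarrow> 'a list \<Rightarrow> bool" where
  "saturated x y xs \<longleftrightarrow> xs \<noteq> [] \<and> hd xs = x \<and> last xs = y \<and> successively E xs"

lemma saturated_maximal: "(x, y) \<in> r \<Longrightarrow> maximal_chain r x y xs \<longleftrightarrow> saturated x y xs"
  using maximal_chain_iff_saturated[OF po] covers_iff
  by (simp add: saturated_def successively_conv_nth)

lemma saturated_Cons:
  "saturated x y (a # xs) \<longleftrightarrow> a = x \<and> (xs = [] \<and> x = y \<or> xs \<noteq> [] \<and> E x (hd xs) \<and> saturated (hd xs) y xs)"
  by (cases xs) (auto simp: saturated_def)

lemma refl_right: "(x, y) \<in> r \<Longrightarrow> (y, y) \<in> r"
  using po by (auto simp: order_on_defs refl_on_def Field_def)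

lemma r_trans: "(x, y) \<in> r \<Longrightarrow> (y, z) \<in> r \<Longrightarrow> (x, z) \<in> r"
  using po by (meson order_on_defs(1,2) transD)

lemma saturated_le: "saturated x y xs \<Longrightarrow> x = y \<or> (x, y) \<in> r \<and> rk x < rk y"
proof (induction xs arbitrary: x)
  case Nil
  then show ?case by (simp add: saturated_def)
next
  case (Cons a xs)
  then show ?case
    unfolding saturated_Cons using E_r E_rk r_trans by (metis Suc_lessD lessI)
qed

lemma label_word_Cons:
  "xs \<noteq> [] \<Longrightarrow> label_word lab (x # xs) = lab (x, hd xs) # label_word lab xs"
  by (cases xs) (auto simp: label_word_def)

lemma sorted_label_word_Cons:
  assumes "xs \<noteq> []" "hd xs = w" "tl xs \<noteq> []"
  shows "sorted_wrt (<) (label_word lab (x # xs)) \<longleftrightarrow>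
    lab (x, w) < lab (w, hd (tl xs)) \<and> sorted_wrt (<) (label_word lab xs)"
proof -
  obtain v vs where "xs = w # v # vs" using assms by (metis list.exhaust_sel)
  then show ?thesis by (auto simp: label_word_def)
qed

text \<open>By induction on the rank difference. The chain through \<open>u\<close> rises, and it
  beats every chain through another atom at the first letter. A rising chain through some
  \<open>w\<close> other than \<open>u\<close> is impossible: its tail would be the distinguished
  chain of \<open>[w, y]\<close>, hence start with a label no larger than that of the step to
  \<open>v\<close>, which does not exceed the label of the step from \<open>x\<close> to
  \<open>w\<close>.\<close>

lemma unique_increasing_chain:
  assumes "(x, y) \<in> r"
  shows "\<exists>xs. saturated x y xs \<and> sorted_wrt (<) (label_word lab xs) \<and>
    (\<forall>ys. saturated x y ys \<and> ys \<noteq> xs \<longrightarrow> \<not> sorted_wrt (<) (label_word lab ys) \<and>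
       (label_word lab xs, label_word lab ys) \<in> lexord {(a, b). a < b})"
  using assms
proof (induction "rk y - rk x" arbitrary: x rule: less_induct)
  case less
  show ?case
  proof (cases "x = y")
    case True
    have "ys = [x]" if s: "saturated x y ys" for ys
    proof (cases ys)
      case Nil
      then show ?thesis using s by (simp add: saturated_def)
    next
      case (Cons a zs)
      have "zs = []"
      proof (rule ccontr)
        assume "zs \<noteq> []"
        then have "E x (hd zs)" "saturated (hd zs) y zs" using s Cons saturated_Cons by auto
        then show False using saturated_le[of "hd zs" y zs] E_rk[of x "hd zs"] True by auto
      qed
      then show ?thesis using s Cons saturated_Cons by simp
    qed
    then show ?thesis using True
      by (intro exI[of _ "[x]"]) (auto simp: saturated_def label_word_def)
  next
    case False
    from first_step[OF less.prems False] obtain u where u: "E x u" "(u, y) \<in> r"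
      and min: "\<And>w. E x w \<Longrightarrow> (w, y) \<in> r \<Longrightarrow> w \<noteq> u \<Longrightarrow> lab (x, u) < lab (x, w) \<and>
         (\<exists>v. E w v \<and> (v, y) \<in> r \<and> lab (w, v) \<le> lab (x, w))"
      and asc: "\<And>v. E u v \<Longrightarrow> (v, y) \<in> r \<Longrightarrow> lab (x, u) < lab (u, v)" by blast
    have rk_le: "rk w \<le> rk y" if "(w, y) \<in> r" for w using r_rk[OF that] by (cases "w = y") auto
    have IH: "\<exists>xs. saturated w y xs \<and> sorted_wrt (<) (label_word lab xs) \<and>
      (\<forall>ys. saturated w y ys \<and> ys \<noteq> xs \<longrightarrow> \<not> sorted_wrt (<) (label_word lab ys) \<and>
       (label_word lab xs, label_word lab ys) \<in> lexord {(a, b). a < b})"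
      if "rk x < rk w" "(w, y) \<in> r" for w
      using less.hyps[of w] that rk_le[OF that(2)] by (metis diff_less_mono2 order_less_le_trans)
    obtain us where us: "saturated u y us" "sorted_wrt (<) (label_word lab us)"
      "\<And>ys. saturated u y ys \<Longrightarrow> ys \<noteq> us \<Longrightarrow> \<not> sorted_wrt (<) (label_word lab ys) \<and>
       (label_word lab us, label_word lab ys) \<in> lexord {(a, b). a < b}"
      using IH[of u] u E_rk[OF u(1)] by (metis lessI)
    have us0: "us \<noteq> []" "hd us = u" using us by (auto simp: saturated_def)
    show ?thesis
    proof (rule exI[of _ "x # us"], rule conjI[OF _ conjI[OF _ allI[OF impI]]])
      show "saturated x y (x # us)" using us us0 u by (simp add: saturated_Cons)
      show "sorted_wrt (<) (label_word lab (x # us))"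
      proof (cases "tl us = []")
        case True
        then have "us = [u]" using us0 by (metis list.collapse)
        then show ?thesis by (simp add: label_word_def)
      next
        case False
        obtain v vs where v: "us = u # v # vs" using us0 False by (metis list.collapse)
        then have "E u v" "saturated v y (v # vs)" using us by (auto simp: saturated_Cons)
        then have "lab (x, u) < lab (u, v)"
          using asc saturated_le[of v y "v # vs"] refl_right[OF u(2)] by metis
        then show ?thesis using sorted_label_word_Cons[OF us0 False] us v by simp
      qed
    next
      fix ys assume a: "saturated x y ys \<and> ys \<noteq> x # us"
      obtain ws where ws: "ys = x # ws" "ws \<noteq> []" "E x (hd ws)" "saturated (hd ws) y ws"
        using a False by (cases ys) (auto simp: saturated_Cons, auto simp: saturated_def)
      define w where "w = hd ws"
      have wy: "(w, y) \<in> r" using saturated_le[OF ws(4)] refl_right[OF u(2)] by (auto simp: w_def)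
      show "\<not> sorted_wrt (<) (label_word lab ys) \<and>
         (label_word lab (x # us), label_word lab ys) \<in> lexord {(a, b). a < b}"
      proof (cases "w = u")
        case True
        then have "saturated u y ws" "ws \<noteq> us" using ws a w_def by auto
        from us(3)[OF this] show ?thesis
          using True ws us0 by (auto simp: label_word_Cons w_def)
      next
        case neq: False
        from min[OF _ wy neq] ws obtain v where lt: "lab (x, u) < lab (x, w)"
          and v: "E w v" "(v, y) \<in> r" "lab (w, v) \<le> lab (x, w)" by (auto simp: w_def)
        have lex: "(label_word lab (x # us), label_word lab ys) \<in> lexord {(a, b). a < b}"
          using lt ws us0 by (simp add: label_word_Cons w_def)
        have "\<not> sorted_wrt (<) (label_word lab ys)"
        proof
          assume srt: "sorted_wrt (<) (label_word lab ys)"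
          have rkw: "rk x < rk w" using ws E_rk w_def by auto
          then have rkv: "rk x < rk v" using E_rk[OF v(1)] by simp
          have wny: "w \<noteq> y" using rk_le[OF v(2)] E_rk[OF v(1)] by auto
          have srt': "sorted_wrt (<) (label_word lab ws)"
            using srt ws by (simp add: label_word_Cons)
          from IH[OF rkw wy] obtain cs where cs: "\<And>ys. saturated w y ys \<Longrightarrow> ys \<noteq> cs \<Longrightarrow>
            \<not> sorted_wrt (<) (label_word lab ys) \<and>
            (label_word lab cs, label_word lab ys) \<in> lexord {(a, b). a < b}" by blast
          have wscs: "ws = cs" using cs ws srt' w_def by blast
          from IH[OF rkv v(2)] obtain vs where vs: "saturated v y vs" by blast
          then have vs0: "vs \<noteq> []" "hd vs = v" by (auto simp: saturated_def)
          \<comment> \<open>Any chain of \<open>[w, y]\<close> through \<open>v\<close> will do,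
            since the lexicographic minimality of \<open>ws\<close> is read off at the first letter
            only.\<close>
          have sv: "saturated w y (w # vs)" using vs vs0 v by (simp add: saturated_Cons)
          have tl: "tl ws \<noteq> []"
          proof
            assume "tl ws = []"
            then have "ws = [w]" using ws w_def by (metis list.collapse)
            then show False using ws wny by (simp add: saturated_def)
          qed
          obtain w2 wt where w2: "ws = w # w2 # wt" using tl ws w_def by (metis list.collapse)
          have "lab (w, w2) \<le> lab (w, v)"
          proof (cases "w # vs = ws")
            case True
            then show ?thesis using w2 vs0 by auto
          next
            case False
            then have "(label_word lab ws, label_word lab (w # vs)) \<in> lexord {(a, b). a < b}"
              using cs[OF sv] wscs by auto
            then show ?thesis using vs0 w2 by (auto simp: label_word_Cons)
          qed
          then have "lab (w, w2) \<le> lab (x, w)" using v(3) by simp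
          moreover have "lab (x, w) < lab (w, w2)"
            using srt ws w2 sorted_label_word_Cons[of ws w x] by simp
          ultimately show False by simp
        qed
        with lex show ?thesis by simp
      qed
    qed
  qed
qed

theorem EL_labeling: "EL_labeling r {(a, b). a \<le> b} lab"
proof -
  have LId: "{(a :: 'l, b). a \<le> b} - Id = {(a, b). a < b}" by auto
  have "Field {(a :: 'l, b). a \<le> b} = UNIV" by (auto simp: Field_def)
  moreover have "Partial_order {(a :: 'l, b). a \<le> b}"
    unfolding order_on_defs
    by (auto simp: Field_def refl_on_def intro!: transI antisymI)
  ultimately show ?thesis
    unfolding EL_labeling_def strictly_increasing_def LId
    using unique_increasing_chain saturated_maximal
    by (auto simp: Ball_def)
qed

text \<open>The criterion is checked for substitutions, while the theorem concerns Dowling elements.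
  The locale is carried over along an injection, later \<open>map_option enc\<close>;
  \<open>h\<close> recovers the preimage on which rank and label are computed.\<close>

lemma image:
  assumes inj: "inj_on f (Field r)"
  defines "h \<equiv> inv_into (Field r) f"
  shows "local_EL (map_prod f f ` r) (\<lambda>a b. \<exists>x y. a = f x \<and> b = f y \<and> E x y)
    (\<lambda>a. rk (h a)) (\<lambda>(a, b). lab (h a, h b))"
proof -
  have hf: "h (f x) = x" if "x \<in> Field r" for x using inj that by (simp add: h_def)
  have rF: "x \<in> Field r" "y \<in> Field r" if "(x, y) \<in> r" for x y using that by (auto simp: Field_def)
  have EF: "x \<in> Field r" "y \<in> Field r" if "E x y" for x y using E_r[OF that] rF by blast+
  have fr: "(f x, f y) \<in> map_prod f f ` r \<longleftrightarrow> (x, y) \<in> r" if "x \<in> Field r" "y \<in> Field r" for x y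
  proof
    assume "(f x, f y) \<in> map_prod f f ` r"
    then obtain x' y' where "(x', y') \<in> r" "f x = f x'" "f y = f y'" by auto
    then show "(x, y) \<in> r" using inj_onD[OF inj] that rF by metis
  qed force
  have Ff: "Field (map_prod f f ` r) = f ` Field r" by (force simp: Field_def)
  show ?thesis
  proof
    show "Partial_order (map_prod f f ` r)"
      unfolding order_on_defs Ff
    proof (intro conjI)
      show "map_prod f f ` r \<subseteq> f ` Field r \<times> f ` Field r" using rF by auto
      show "refl_on (f ` Field r) (map_prod f f ` r)"
        using po by (force simp: refl_on_def order_on_defs)
      show "trans (map_prod f f ` r)"
      proof (rule transI)
        fix a b c assume "(a, b) \<in> map_prod f f ` r" "(b, c) \<in> map_prod f f ` r"
        then obtain x y y' z where *: "a = f x" "b = f y" "b = f y'" "c = f z" "(x, y) \<in> r" "(y', z) \<in> r"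
          by fastforce
        then have "y = y'" using inj_onD[OF inj] rF by metis
        then show "(a, c) \<in> map_prod f f ` r" using * r_trans[of x y z] by force
      qed
      show "antisym (map_prod f f ` r)"
      proof (rule antisymI)
        fix a b assume ab: "(a, b) \<in> map_prod f f ` r" "(b, a) \<in> map_prod f f ` r"
        then obtain x y where *: "a = f x" "b = f y" "(x, y) \<in> r" by auto
        then have "(y, x) \<in> r" using ab fr rF by metis
        then have "x = y" using * po unfolding order_on_defs by (blast dest: antisymD)
        then show "a = b" using * by simp
      qed
    qed
  next
    fix a b assume "\<exists>x y. a = f x \<and> b = f y \<and> E x y"
    then show "(a, b) \<in> map_prod f f ` r" using E_r by force
  next
    fix a b assume "\<exists>x y. a = f x \<and> b = f y \<and> E x y"
    then show "rk (h b) = Suc (rk (h a))" using E_rk EF hf by metis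
  next
    fix a b assume "(a, b) \<in> map_prod f f ` r" "a \<noteq> b"
    then show "rk (h a) < rk (h b)" using r_rk hf rF by force
  next
    fix a b assume "(a, b) \<in> map_prod f f ` r" "a \<noteq> b"
    then obtain x y where xy: "a = f x" "b = f y" "(x, y) \<in> r" "x \<noteq> y" by auto
    from first_step[OF xy(3,4)] obtain u where u: "E x u" "(u, y) \<in> r"
      "\<And>w. E x w \<Longrightarrow> (w, y) \<in> r \<Longrightarrow> w \<noteq> u \<Longrightarrow>
        lab (x, u) < lab (x, w) \<and> (\<exists>v. E w v \<and> (v, y) \<in> r \<and> lab (w, v) \<le> lab (x, w))"
      "\<And>v. E u v \<Longrightarrow> (v, y) \<in> r \<Longrightarrow> lab (x, u) < lab (u, v)" by blast
    have yF: "y \<in> Field r" and xF: "x \<in> Field r" and uF: "u \<in> Field r" using xy rF u EF by blast+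
    show "\<exists>u. (\<exists>x y. a = f x \<and> u = f y \<and> E x y) \<and> (u, b) \<in> map_prod f f ` r \<and>
      (\<forall>w. (\<exists>x y. a = f x \<and> w = f y \<and> E x y) \<and> (w, b) \<in> map_prod f f ` r \<and> w \<noteq> u \<longrightarrow>
         (case (a, u) of (a, b) \<Rightarrow> lab (h a, h b)) < (case (a, w) of (a, b) \<Rightarrow> lab (h a, h b)) \<and>
         (\<exists>v. (\<exists>x y. w = f x \<and> v = f y \<and> E x y) \<and> (v, b) \<in> map_prod f f ` r \<and>
            (case (w, v) of (a, b) \<Rightarrow> lab (h a, h b)) \<le> (case (a, w) of (a, b) \<Rightarrow> lab (h a, h b)))) \<and>
      (\<forall>v. (\<exists>x y. u = f x \<and> v = f y \<and> E x y) \<and> (v, b) \<in> map_prod f f ` r \<longrightarrow>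
         (case (a, u) of (a, b) \<Rightarrow> lab (h a, h b)) < (case (u, v) of (a, b) \<Rightarrow> lab (h a, h b)))"
      unfolding prod.case
    proof (rule exI[of _ "f u"], intro conjI allI impI; (elim conjE)?)
      show "\<exists>x y. a = f x \<and> f u = f y \<and> E x y" using xy u by blast
      show "(f u, b) \<in> map_prod f f ` r" using u xy by force
      fix p assume p: "\<exists>x y. a = f x \<and> p = f y \<and> E x y" "(p, b) \<in> map_prod f f ` r" "p \<noteq> f u"
      then obtain w where w: "p = f w" "E x w" using xy EF xF inj_onD[OF inj] by metis
      have wF: "w \<in> Field r" using EF w by blast
      have wy: "(w, y) \<in> r" using p(2) unfolding w(1) xy(2) fr[OF wF yF] .
      from u(3)[OF w(2) wy] p(3) w(1) obtain v where v: "lab (x, u) < lab (x, w)" "E w v" "(v, y) \<in> r"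
        "lab (w, v) \<le> lab (x, w)" by blast
      have vF: "v \<in> Field r" using EF v by blast
      show "lab (h a, h (f u)) < lab (h a, h p)" unfolding xy(1) w(1) hf[OF xF] hf[OF uF] hf[OF wF] by (rule v(1))
      show "\<exists>v. (\<exists>x y. p = f x \<and> v = f y \<and> E x y) \<and> (v, b) \<in> map_prod f f ` r \<and>
          lab (h p, h v) \<le> lab (h a, h p)"
        unfolding xy(1,2) w(1)
        using v fr[OF vF yF] hf[OF xF] hf[OF wF] hf[OF vF] by (intro exI[of _ "f v"]) auto
    next
      fix p assume p: "\<exists>x y. f u = f x \<and> p = f y \<and> E x y" "(p, b) \<in> map_prod f f ` r"
      then obtain v where v: "p = f v" "E u v" using EF uF inj_onD[OF inj] by metis
      have vF: "v \<in> Field r" using EF v by blast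
      have "(v, y) \<in> r" using p(2) unfolding v(1) xy(2) fr[OF vF yF] .
      from u(4)[OF v(2) this] show "lab (h a, h (f u)) < lab (h (f u), h p)"
        unfolding xy(1) v(1) hf[OF xF] hf[OF uF] hf[OF vF] .
    qed
  qed
qed

end

lemma adjoin_top_map_prod:
  "adjoin_top (map_prod f f ` r) = map_prod (map_option f) (map_option f) ` adjoin_top r"
proof -
  let ?m = "map_prod (map_option f) (map_option f)"
  have F: "Field (map_prod f f ` r) = f ` Field r"
    by (force simp: Field_def)
  have "{(Some a, Some b) | a b. (a, b) \<in> map_prod f f ` r} = (\<lambda>(x, y). (Some (f x), Some (f y))) ` r"
    by force
  moreover have "{(Some x, Some y) | x y. (x, y) \<in> r} = (\<lambda>(x, y). (Some x, Some y)) ` r"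
    by force
  moreover have "insert None (Some ` f ` Field r) \<times> {None} = ?m ` (insert None (Some ` Field r) \<times> {None})"
    by force
  ultimately show ?thesis
    unfolding adjoin_top_def F image_Un by (simp add: image_image case_prod_unfold)
qed

section \<open>Elements as idempotent substitutions\<close>

text \<open>
  An element \<open>(\<beta>, z)\<close> is encoded by a function \<open>x\<close> on \<open>{1..n}\<close>: \<open>x i = Inr s\<close> means that \<open>i\<close> lies in the
  zero block and has colour \<open>s\<close>, while \<open>x i = Inl (m, g)\<close> means that \<open>i\<close> lies in a block \<open>B\<close> with
  \<open>m = Min B\<close> and \<open>b i = g \<otimes> b m\<close>. Reading \<open>Inl (m, g)\<close> as the term \<open>g \<cdot> m\<close> in the variable \<open>m\<close>, such an
  \<open>x\<close> is an idempotent substitution, and the order relation becomes \<open>y \<circ> x = y\<close>.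
\<close>

locale dowling_model = group_action G S \<phi>
  for G (structure) and S :: "'s set" and \<phi> +
  fixes n :: nat and T :: "'s set" and idx :: "'s \<Rightarrow> nat"
  assumes T_sub: "T \<subseteq> S"
    and T_inv: "g \<in> carrier G \<Longrightarrow> s \<in> T \<Longrightarrow> \<phi> g s \<in> T"
    and trivial: "g \<in> carrier G \<Longrightarrow> s \<in> S - T \<Longrightarrow> \<phi> g s = s"
    and idx_inj: "inj_on idx S"
    and n2: "2 \<le> n"
    and S_ne: "S \<noteq> {}"
begin

sublocale group G
  using group_hom group_hom.axioms(1) by auto

lemma \<phi>_one: "s \<in> S \<Longrightarrow> \<phi> \<one> s = s"
  using id_eq_one by (metis restrict_apply')

lemma \<phi>_closed: "g \<in> carrier G \<Longrightarrow> s \<in> S \<Longrightarrow> \<phi> g s \<in> S"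
  using element_image by blast

definition terms :: "(nat \<times> 'a + 's) set" where
  "terms = Inl ` ({1..n} \<times> carrier G) \<union> Inr ` S"

definition act :: "'a \<Rightarrow> nat \<times> 'a + 's \<Rightarrow> nat \<times> 'a + 's" where
  "act g t = (case t of Inl (m, k) \<Rightarrow> Inl (m, g \<otimes> k) | Inr s \<Rightarrow> Inr (\<phi> g s))"

definition app :: "(nat \<Rightarrow> nat \<times> 'a + 's) \<Rightarrow> nat \<times> 'a + 's \<Rightarrow> nat \<times> 'a + 's" where
  "app y t = (case t of Inl (m, g) \<Rightarrow> act g (y m) | Inr s \<Rightarrow> Inr s)"

text \<open>Only block minima occur in the terms, and they are fixed. The left factor
  \<open>b i \<otimes> inv (b m)\<close> does not change when \<open>b\<close> is multiplied by a
  group element on the right, so every block has exactly one code.\<close>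

definition substs :: "(nat \<Rightarrow> nat \<times> 'a + 's) set" where
  "substs = {x \<in> {1..n} \<rightarrow>\<^sub>E terms.
     \<forall>i\<in>{1..n}. \<forall>m g. x i = Inl (m, g) \<longrightarrow> m \<le> i \<and> x m = Inl (m, \<one>)}"

definition roots :: "(nat \<Rightarrow> nat \<times> 'a + 's) \<Rightarrow> nat set" where
  "roots x = {d \<in> {1..n}. x d = Inl (d, \<one>)}"

definition le :: "(nat \<Rightarrow> nat \<times> 'a + 's) \<Rightarrow> (nat \<Rightarrow> nat \<times> 'a + 's) \<Rightarrow> bool" where
  "le x y \<longleftrightarrow> (\<forall>i\<in>{1..n}. y i = app y (x i))"

text \<open>The right-hand sides permitted in an equation for the root \<open>d\<close>. Requiring
  \<open>e < d\<close> keeps the surviving root the minimum of the merged block.\<close>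

definition targets :: "(nat \<Rightarrow> nat \<times> 'a + 's) \<Rightarrow> nat \<Rightarrow> (nat \<times> 'a + 's) set" where
  "targets x d = {Inl (e, g) | e g. e \<in> roots x \<and> e < d \<and> g \<in> carrier G} \<union> Inr ` S"

definition step :: "(nat \<Rightarrow> nat \<times> 'a + 's) \<Rightarrow> nat \<Rightarrow> nat \<times> 'a + 's \<Rightarrow> nat \<Rightarrow> nat \<times> 'a + 's" where
  "step x d t = (\<lambda>i\<in>{1..n}. case x i of
     Inl (m, g) \<Rightarrow> if m = d then act g t else x i | Inr s \<Rightarrow> Inr s)"

definition colour_class :: "(nat \<Rightarrow> nat \<times> 'a + 's) \<Rightarrow> 's \<Rightarrow> nat set" where
  "colour_class x s = {i \<in> {1..n}. x i = Inr s}"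

text \<open>The orbits inside \<open>S - T\<close> are singletons, as the action is trivial there.
  The size condition on orbits is therefore a condition on single colours.\<close>

definition P :: "(nat \<Rightarrow> nat \<times> 'a + 's) set" where
  "P = {x \<in> substs. \<forall>s\<in>S - T. card (colour_class x s) \<noteq> 1}"

lemma act_simps [simp]:
  "act g (Inl (m, k)) = Inl (m, g \<otimes> k)" "act g (Inr s) = Inr (\<phi> g s)"
  by (simp_all add: act_def)

lemma app_simps [simp]: "app y (Inl (m, g)) = act g (y m)" "app y (Inr s) = Inr s"
  by (simp_all add: app_def)

lemma terms_simps [simp]:
  "Inl (m, g) \<in> terms \<longleftrightarrow> m \<in> {1..n} \<and> g \<in> carrier G" "Inr s \<in> terms \<longleftrightarrow> s \<in> S"
  by (auto simp: terms_def)

lemma terms_cases: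
  assumes "t \<in> terms"
  obtains m g where "t = Inl (m, g)" "m \<in> {1..n}" "g \<in> carrier G" | s where "t = Inr s" "s \<in> S"
  using assms by (auto simp: terms_def)

lemma act_one: "t \<in> terms \<Longrightarrow> act \<one> t = t"
  by (erule terms_cases) (auto simp: \<phi>_one)

lemma act_closed: "g \<in> carrier G \<Longrightarrow> t \<in> terms \<Longrightarrow> act g t \<in> terms"
  by (erule terms_cases) (auto simp: \<phi>_closed)

lemma act_act:
  "g \<in> carrier G \<Longrightarrow> h \<in> carrier G \<Longrightarrow> t \<in> terms \<Longrightarrow> act g (act h t) = act (g \<otimes> h) t"
  by (erule terms_cases) (auto simp: m_assoc composition_rule)

lemma act_inv: "g \<in> carrier G \<Longrightarrow> t \<in> terms \<Longrightarrow> act g t = u \<Longrightarrow> t = act (inv g) u"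
  using act_act[of "inv g" g t] act_one by auto

lemma substs_terms: "x \<in> substs \<Longrightarrow> i \<in> {1..n} \<Longrightarrow> x i \<in> terms"
  unfolding substs_def by (blast dest: PiE_mem)

lemma substs_ext: "x \<in> substs \<Longrightarrow> i \<notin> {1..n} \<Longrightarrow> x i = undefined"
  unfolding substs_def by (blast dest: PiE_arb)

lemma substs_Inl:
  assumes "x \<in> substs" "i \<in> {1..n}" "x i = Inl (m, g)"
  shows "m \<in> roots x" "m \<le> i" "m \<in> {1..n}" "g \<in> carrier G"
proof -
  have "Inl (m, g) \<in> terms" using substs_terms[OF assms(1,2)] assms(3) by simp
  then show "m \<in> {1..n}" "g \<in> carrier G" by auto
  then show "m \<in> roots x" "m \<le> i" using assms unfolding substs_def roots_def by blast+
qed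

lemma substs_Inr: "x \<in> substs \<Longrightarrow> i \<in> {1..n} \<Longrightarrow> x i = Inr s \<Longrightarrow> s \<in> S"
  using substs_terms by fastforce

lemma rootsD: "d \<in> roots x \<Longrightarrow> d \<in> {1..n}" "d \<in> roots x \<Longrightarrow> x d = Inl (d, \<one>)"
  by (auto simp: roots_def)

lemma finite_roots: "finite (roots x)"
  by (simp add: roots_def)

lemma app_act_eq:
  assumes "y \<in> substs" "g \<in> carrier G" "t \<in> terms"
  shows "app y (act g t) = act g (app y t)"
  using assms(3) by (cases rule: terms_cases) (auto simp: act_act assms substs_terms)

lemma le_at: "le x y \<Longrightarrow> i \<in> {1..n} \<Longrightarrow> y i = app y (x i)"
  unfolding le_def by blast

lemma le_refl: "x \<in> substs \<Longrightarrow> le x x"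
  unfolding le_def
proof
  fix i assume x: "x \<in> substs" and i: "i \<in> {1..n}"
  show "x i = app x (x i)"
    using substs_terms[OF x i]
  proof (cases rule: terms_cases)
    case (1 m g)
    then show ?thesis using rootsD(2)[OF substs_Inl(1)[OF x i 1(1)]] by simp
  qed simp
qed

lemma le_trans:
  assumes "x \<in> substs" "y \<in> substs" "z \<in> substs" "le x y" "le y z"
  shows "le x z"
  unfolding le_def
proof
  fix i assume i: "i \<in> {1..n}"
  have e: "y i = app y (x i)" "z i = app z (y i)" using le_at i assms by metis+
  show "z i = app z (x i)"
    using substs_terms[OF assms(1) i]
  proof (cases rule: terms_cases)
    case (1 m g)
    then show ?thesis
      using e app_act_eq[OF assms(3) 1(3) substs_terms[OF assms(2) 1(2)]]
        le_at[OF assms(5) 1(2)] by simp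
  qed (use e in simp)
qed

lemma le_Inr: "le x y \<Longrightarrow> i \<in> {1..n} \<Longrightarrow> x i = Inr s \<Longrightarrow> y i = Inr s"
  using le_at[of x y i] by simp

lemma le_Inl: "le x y \<Longrightarrow> i \<in> {1..n} \<Longrightarrow> x i = Inl (m, g) \<Longrightarrow> y i = act g (y m)"
  using le_at[of x y i] by simp

lemma act_Inl_cases:
  assumes "act g t = Inl (m, k)"
  obtains h where "t = Inl (m, h)" "k = g \<otimes> h"
  using assms by (cases t) auto

lemma act_Inr_cases:
  assumes "act g t = Inr s"
  obtains s' where "t = Inr s'" "s = \<phi> g s'"
  using assms by (cases t) auto

lemma le_roots:
  assumes "x \<in> substs" "y \<in> substs" "le x y"
  shows "roots y \<subseteq> roots x"
proof
  fix d assume d: "d \<in> roots y"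
  have dn: "d \<in> {1..n}" "y d = Inl (d, \<one>)" using rootsD[OF d] by auto
  show "d \<in> roots x"
    using substs_terms[OF assms(1) dn(1)]
  proof (cases rule: terms_cases)
    case (1 m g)
    have "act g (y m) = Inl (d, \<one>)" using le_Inl[OF assms(3) dn(1) 1(1)] dn by simp
    then obtain h where "y m = Inl (d, h)" by (rule act_Inl_cases)
    then have "d \<le> m" using substs_Inl(2)[OF assms(2) 1(2)] by simp
    moreover have "m \<le> d" "m \<in> roots x" using substs_Inl[OF assms(1) dn(1) 1(1)] by auto
    ultimately show ?thesis by simp
  next
    case (2 s)
    then show ?thesis using le_Inr[OF assms(3) dn(1) 2(1)] dn by simp
  qed
qed

text \<open>The term \<open>y i\<close> arises from \<open>x i\<close> by replacing the root in it
  by its value in \<open>y\<close>, so nothing changes while every root survives. This is why the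
  number of roots is a strict measure for the order.\<close>

lemma le_roots_eq:
  assumes "x \<in> substs" "y \<in> substs" "le x y" "roots x \<subseteq> roots y"
  shows "x = y"
proof
  fix i show "x i = y i"
  proof (cases "i \<in> {1..n}")
    case i: True
    show ?thesis
      using substs_terms[OF assms(1) i]
    proof (cases rule: terms_cases)
      case (1 m g)
      then have "m \<in> roots y" using substs_Inl[OF assms(1) i 1(1)] assms(4) by auto
      from rootsD(2)[OF this] show ?thesis using le_Inl[OF assms(3) i 1(1)] 1 by simp
    next
      case (2 s)
      then show ?thesis using le_Inr[OF assms(3) i 2(1)] by simp
    qed
  next
    case False
    then show ?thesis using assms(1,2) substs_ext by metis
  qed
qed

lemma le_antisym: "x \<in> substs \<Longrightarrow> y \<in> substs \<Longrightarrow> le x y \<Longrightarrow> le y x \<Longrightarrow> x = y"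
  using le_roots le_roots_eq by metis

lemma le_roots_psubset:
  "x \<in> substs \<Longrightarrow> y \<in> substs \<Longrightarrow> le x y \<Longrightarrow> x \<noteq> y \<Longrightarrow> roots y \<subset> roots x"
  using le_roots le_roots_eq by (metis psubsetI)

lemma targets_cases:
  assumes "t \<in> targets x d"
  obtains e g where "t = Inl (e, g)" "e \<in> roots x" "e < d" "g \<in> carrier G"
    | s where "t = Inr s" "s \<in> S"
  using assms by (auto simp: targets_def)

lemma targets_terms: "t \<in> targets x d \<Longrightarrow> t \<in> terms"
  by (erule targets_cases) (auto dest: rootsD(1))

lemma step_at:
  assumes "i \<in> {1..n}"
  shows "x i = Inr s \<Longrightarrow> step x d t i = Inr s"
    and "x i = Inl (m, g) \<Longrightarrow> m \<noteq> d \<Longrightarrow> step x d t i = Inl (m, g)"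
    and "x i = Inl (d, g) \<Longrightarrow> step x d t i = act g t"
  using assms by (auto simp: step_def)

lemma step_root: "d \<in> roots x \<Longrightarrow> t \<in> terms \<Longrightarrow> step x d t d = t"
  using step_at(3)[of d x d \<one> t] rootsD[of d x] by (simp add: act_one)

lemma step_other_root: "a \<in> roots x \<Longrightarrow> a \<noteq> d \<Longrightarrow> step x d t a = Inl (a, \<one>)"
  using step_at(2)[of a x a \<one> d t] rootsD[of a x] by simp

lemma step_roots:
  assumes x: "x \<in> substs" and d: "d \<in> roots x" and t: "t \<in> targets x d"
  shows "roots (step x d t) = roots x - {d}"
proof
  show "roots x - {d} \<subseteq> roots (step x d t)"
    using step_other_root rootsD(1) by (auto simp: roots_def)
  show "roots (step x d t) \<subseteq> roots x - {d}"
  proof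
    fix a assume a: "a \<in> roots (step x d t)"
    have an: "a \<in> {1..n}" "step x d t a = Inl (a, \<one>)" using rootsD[OF a] by auto
    show "a \<in> roots x - {d}"
      using substs_terms[OF x an(1)]
    proof (cases rule: terms_cases)
      case (1 m g)
      have mr: "m \<in> roots x" "m \<le> a" using substs_Inl[OF x an(1) 1(1)] by auto
      show ?thesis
      proof (cases "m = d")
        case True
        have "act g t = Inl (a, \<one>)" using step_at(3)[where x = x, OF an(1)] 1(1) True an(2) by auto
        then obtain h where "t = Inl (a, h)" by (rule act_Inl_cases)
        then show ?thesis using t mr True by (auto simp: targets_def)
      next
        case False
        then have "m = a" using step_at(2)[where x = x, OF an(1) 1(1) False] an(2) by simp
        then show ?thesis using mr False by simp
      qed
    next
      case (2 s)
      then show ?thesis using step_at(1)[where x = x, OF an(1) 2(1)] an(2) by simp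
    qed
  qed
qed

lemma step_substs:
  assumes x: "x \<in> substs" and d: "d \<in> roots x" and t: "t \<in> targets x d"
  shows "step x d t \<in> substs"
proof -
  have tt: "t \<in> terms" using targets_terms[OF t] .
  have *: "step x d t i \<in> terms \<and>
    (\<forall>m g. step x d t i = Inl (m, g) \<longrightarrow> m \<le> i \<and> step x d t m = Inl (m, \<one>))"
    if i: "i \<in> {1..n}" for i
    using substs_terms[OF x i]
  proof (cases rule: terms_cases)
    case (1 m g)
    have mr: "m \<in> roots x" "m \<le> i" using substs_Inl[OF x i 1(1)] by auto
    show ?thesis
    proof (cases "m = d")
      case True
      have s: "step x d t i = act g t" using step_at(3)[where x = x, OF i] 1(1) True by auto
      have "m' \<le> i \<and> step x d t m' = Inl (m', \<one>)" if at: "act g t = Inl (m', g')" for m' g'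
      proof -
        obtain h where h: "t = Inl (m', h)" using at by (rule act_Inl_cases)
        then have "m' < d" "m' \<in> roots x" using t by (auto simp: targets_def)
        then show ?thesis using mr True step_other_root[of m' x d t] by auto
      qed
      then show ?thesis using s act_closed[OF 1(3) tt] by simp
    next
      case False
      then show ?thesis
        using step_at(2)[where x = x, OF i 1(1) False] mr step_other_root[OF mr(1) False] 1 by auto
    qed
  next
    case (2 s)
    then show ?thesis using step_at(1)[where x = x, OF i 2(1)] by simp
  qed
  moreover have "step x d t \<in> extensional {1..n}" by (simp add: step_def)
  ultimately show ?thesis unfolding substs_def PiE_def by blast
qed

text \<open>\<open>x\<close> and \<open>step x d t\<close> differ only by the substitution of
  \<open>t\<close> for the variable \<open>d\<close>, so the single equation \<open>d = t\<close>
  decides whether \<open>y\<close> stays above. Every later test for lying in an interval reduces to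
  it.\<close>

lemma le_step_iff:
  assumes x: "x \<in> substs" and y: "y \<in> substs" and xy: "le x y"
    and d: "d \<in> roots x" and t: "t \<in> targets x d"
  shows "le (step x d t) y \<longleftrightarrow> app y t = y d"
proof
  assume "le (step x d t) y"
  then show "app y t = y d"
    using le_at[of "step x d t" y d] step_root[OF d targets_terms[OF t]] rootsD(1)[OF d] by simp
next
  assume e: "app y t = y d"
  show "le (step x d t) y"
    unfolding le_def
  proof
    fix i assume i: "i \<in> {1..n}"
    show "y i = app y (step x d t i)"
      using substs_terms[OF x i]
    proof (cases rule: terms_cases)
      case (1 m g)
      show ?thesis
      proof (cases "m = d")
        case True
        then show ?thesis
          using step_at(3)[where x = x, OF i] 1 le_Inl[OF xy i 1(1)]
          by (simp add: app_act_eq[OF y 1(3) targets_terms[OF t]] e)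
      next
        case False
        then show ?thesis using step_at(2)[where x = x, OF i 1(1) False] le_Inl[OF xy i 1(1)] by simp
      qed
    next
      case (2 s)
      then show ?thesis using step_at(1)[where x = x, OF i 2(1)] le_Inr[OF xy i 2(1)] by simp
    qed
  qed
qed

lemma le_step:
  assumes x: "x \<in> substs" and d: "d \<in> roots x" and t: "t \<in> targets x d"
  shows "le x (step x d t)"
  unfolding le_def
proof
  fix i assume i: "i \<in> {1..n}"
  show "step x d t i = app (step x d t) (x i)"
    using substs_terms[OF x i]
  proof (cases rule: terms_cases)
    case (1 m g)
    show ?thesis
    proof (cases "m = d")
      case True
      then show ?thesis
        using step_at(3)[where x = x, OF i] 1 by (simp add: step_root[OF d targets_terms[OF t]])
    next
      case False
      then show ?thesis
        using step_at(2)[where x = x, OF i 1(1) False] 1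
          step_other_root[OF substs_Inl(1)[OF x i 1(1)] False] by simp
    qed
  next
    case (2 s)
    then show ?thesis using step_at(1)[where x = x, OF i 2(1)] by simp
  qed
qed

text \<open>Since \<open>y\<close> is idempotent, its own value at \<open>d\<close> is a permitted
  right-hand side. The resulting step may leave \<open>P\<close>, so it serves to generate the order
  on all substitutions and not to find covers in \<open>P\<close>.\<close>

lemma canonical_target:
  assumes x: "x \<in> substs" and y: "y \<in> substs" and xy: "le x y"
    and d: "d \<in> roots x" and nd: "d \<notin> roots y"
  shows "y d \<in> targets x d" "app y (y d) = y d"
proof -
  have dn: "d \<in> {1..n}" using rootsD[OF d] by auto
  show "app y (y d) = y d" using le_at[OF le_refl[OF y] dn] by simp
  show "y d \<in> targets x d"
    using substs_terms[OF y dn]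
  proof (cases rule: terms_cases)
    case (1 m g)
    have "m \<in> roots y" "m \<le> d" using substs_Inl[OF y dn 1(1)] by auto
    then show ?thesis using 1 le_roots[OF x y xy] nd by (auto simp: targets_def nat_less_le)
  next
    case (2 s)
    then show ?thesis by (auto simp: targets_def)
  qed
qed

lemma P_substs: "x \<in> P \<Longrightarrow> x \<in> substs"
  by (simp add: P_def)

lemma step_merge_P:
  assumes x: "x \<in> P" and d: "d \<in> roots x" and t: "Inl (e, g) \<in> targets x d"
  shows "step x d (Inl (e, g)) \<in> P"
proof -
  have "step x d (Inl (e, g)) i = Inr s \<longleftrightarrow> x i = Inr s" if i: "i \<in> {1..n}" for i s
    using i by (auto simp: step_def split: sum.splits)
  then have "colour_class (step x d (Inl (e, g))) s = colour_class x s" for s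
    by (auto simp: colour_class_def)
  then show ?thesis using x step_substs[OF P_substs[OF x] d t] by (simp add: P_def)
qed

text \<open>A colour \<open>s\<close> outside \<open>T\<close> is fixed by the action, so the whole
  block of \<open>d\<close> receives it, and each of the last two alternatives provides an element
  besides \<open>d\<close> in its class. The classes of the other colours outside \<open>T\<close>
  do not change: \<open>T\<close> is invariant, and a colour outside \<open>T\<close> is the image
  of itself only.\<close>

lemma step_colour_P:
  assumes x: "x \<in> P" and d: "d \<in> roots x" and s: "s \<in> S"
    and c: "s \<in> T \<or> colour_class x s \<noteq> {} \<or> (\<exists>i\<in>{1..n}. i \<noteq> d \<and> (\<exists>g. x i = Inl (d, g)))"
  shows "step x d (Inr s) \<in> P"
proof -
  have t: "Inr s \<in> targets x d" using s by (simp add: targets_def)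
  define y where "y = step x d (Inr s)"
  have ys: "y \<in> substs" using step_substs[OF P_substs[OF x] d t] by (simp add: y_def)
  have sub: "colour_class x s' \<subseteq> colour_class y s'" for s'
    using step_at(1) by (auto simp: colour_class_def y_def)
  have "card (colour_class y s') \<noteq> 1" if s': "s' \<in> S - T" for s'
  proof (cases "s' = s")
    case True
    have triv: "\<phi> g s = s" if "g \<in> carrier G" for g using trivial that s' True by simp
    have blk: "i \<in> colour_class y s" if "i \<in> {1..n}" "x i = Inl (d, g)" for i g
      using step_at(3)[where x = x, OF that, of "Inr s"] triv substs_Inl(4)[OF P_substs[OF x] that] that
      by (auto simp: colour_class_def y_def)
    have dy: "d \<in> colour_class y s" using blk rootsD[OF d] by blast
    have "\<exists>i\<in>colour_class y s. i \<noteq> d"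
    proof (cases "colour_class x s = {}")
      case True
      then show ?thesis using c s' \<open>s' = s\<close> blk by auto
    next
      case False
      then obtain i where i: "i \<in> colour_class x s" by auto
      then have "i \<noteq> d" using rootsD(2)[OF d] by (auto simp: colour_class_def)
      then show ?thesis using i sub by auto
    qed
    then show ?thesis using dy True by (auto simp: card_1_singleton_iff)
  next
    case False
    have "colour_class y s' \<subseteq> colour_class x s'"
    proof
      fix i assume "i \<in> colour_class y s'"
      then have i: "i \<in> {1..n}" "y i = Inr s'" by (auto simp: colour_class_def)
      show "i \<in> colour_class x s'"
        using substs_terms[OF P_substs[OF x] i(1)]
      proof (cases rule: terms_cases)
        case (1 m g)
        have "m = d" using step_at(2)[where x = x, OF i(1) 1(1)] i(2) y_def by force
        then have "\<phi> g s = s'" using step_at(3)[where x = x, OF i(1)] 1 i(2) y_def by force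
        then have "s \<notin> T" using T_inv 1(3) s' by auto
        then show ?thesis using trivial[OF 1(3)] s \<open>\<phi> g s = s'\<close> False by auto
      next
        case (2 u)
        then show ?thesis using step_at(1)[where x = x, OF i(1) 2(1)] i y_def by (auto simp: colour_class_def)
      qed
    qed
    then have "colour_class y s' = colour_class x s'" using sub by auto
    then show ?thesis using x s' by (simp add: P_def)
  qed
  then show ?thesis using ys by (simp add: P_def y_def)
qed

text \<open>If \<open>s\<close> is outside \<open>T\<close>, membership of \<open>y\<close> in
  \<open>P\<close> yields an element other than \<open>d\<close> with colour \<open>s\<close> in
  \<open>y\<close>. In \<open>x\<close> it is either coloured already or in a block whose root has
  the colour \<open>s\<close> in \<open>y\<close>, because the action fixes \<open>s\<close>; that
  root is \<open>d\<close> by \<open>inj\<close>. In both cases \<open>step_colour_P\<close>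
  applies.\<close>

lemma forced_colour_P:
  assumes x: "x \<in> P" and y: "y \<in> P" and xy: "le x y" and d: "d \<in> roots x" and yd: "y d = Inr s"
    and inj: "\<And>a. a \<in> roots x \<Longrightarrow> y a = Inr s \<Longrightarrow> a = d"
  shows "step x d (Inr s) \<in> P"
proof -
  have dn: "d \<in> {1..n}" using rootsD[OF d] by auto
  have s: "s \<in> S" using substs_Inr[OF P_substs[OF y] dn yd] .
  have "colour_class x s \<noteq> {} \<or> (\<exists>i\<in>{1..n}. i \<noteq> d \<and> (\<exists>g. x i = Inl (d, g)))" if "s \<notin> T"
  proof -
    have "card (colour_class y s) \<noteq> 1" using y s that by (simp add: P_def)
    moreover have "d \<in> colour_class y s" using dn yd by (simp add: colour_class_def)
    ultimately obtain i where i: "i \<in> colour_class y s" "i \<noteq> d"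
      by (metis is_singletonI' is_singleton_altdef empty_iff)
    then have i': "i \<in> {1..n}" "y i = Inr s" by (auto simp: colour_class_def)
    show ?thesis
      using substs_terms[OF P_substs[OF x] i'(1)]
    proof (cases rule: terms_cases)
      case (1 m g)
      have m: "m \<in> roots x" using substs_Inl(1)[OF P_substs[OF x] i'(1) 1(1)] .
      have a: "act g (y m) = Inr s" using le_Inl[OF xy i'(1) 1(1)] i' by simp
      have "y m = act (inv g) (Inr s)"
        using act_inv[OF 1(3) substs_terms[OF P_substs[OF y] 1(2)] a] .
      then have "y m = Inr s" using trivial[of "inv g" s] 1(3) s that by simp
      then have "m = d" using inj m by simp
      then show ?thesis using i i' 1 by blast
    next
      case (2 u)
      then have "u = s" using le_Inr[OF xy i'(1) 2(1)] i' by simp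
      then show ?thesis using 2 i' by (auto simp: colour_class_def)
    qed
  qed
  then show ?thesis using step_colour_P[OF x d s] by blast
qed

section \<open>The labeling\<close>

definition class_min :: "(nat \<Rightarrow> nat \<times> 'a + 's) \<Rightarrow> nat \<Rightarrow> nat" where
  "class_min y d = (LEAST j. j \<in> {1..n} \<and> y j = y d)"

definition edge :: "(nat \<Rightarrow> nat \<times> 'a + 's) \<Rightarrow> (nat \<Rightarrow> nat \<times> 'a + 's) \<Rightarrow> bool" where
  "edge x y \<longleftrightarrow> x \<in> P \<and> y \<in> P \<and> (\<exists>d\<in>roots x. \<exists>t\<in>targets x d. y = step x d t)"

definition least_colour :: "(nat \<Rightarrow> nat \<times> 'a + 's) \<Rightarrow> nat \<Rightarrow> 's \<Rightarrow> bool" where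
  "least_colour x d s \<longleftrightarrow> (\<forall>s'\<in>S. step x d (Inr s') \<in> P \<longrightarrow> idx s \<le> idx s')"

text \<open>
  The exceptional value \<open>0\<close> serves elements whose only block is a singleton: there the colour of index
  \<open>0\<close> may be forbidden, but the interval up to the adjoined top still needs a rising chain.
\<close>

definition edge_label :: "(nat \<Rightarrow> nat \<times> 'a + 's) \<Rightarrow> (nat \<Rightarrow> nat \<times> 'a + 's) \<Rightarrow> nat \<times> nat" where
  "edge_label x y = (let d = the_elem (roots x - roots y) in case y d of
     Inl (e, g) \<Rightarrow> if g = \<one> then (0, d) else (2, class_min y d)
   | Inr s \<Rightarrow> (1, if roots y = {} \<and> least_colour x d s then 0 else idx s))"

lemma le_one_less_two: "p \<le> (1, k) \<Longrightarrow> p < (2 :: nat, q :: nat)"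
  by (cases p) auto

lemma class_min_props:
  assumes "d \<in> {1..n}"
  shows "class_min y d \<in> {1..n}" "y (class_min y d) = y d" "class_min y d \<le> d"
  using LeastI[of "\<lambda>j. j \<in> {1..n} \<and> y j = y d" d] Least_le[of "\<lambda>j. j \<in> {1..n} \<and> y j = y d" d] assms
  by (auto simp: class_min_def)

lemma class_min_le: "j \<in> {1..n} \<Longrightarrow> y j = y d \<Longrightarrow> class_min y d \<le> j"
  by (auto simp: class_min_def intro: Least_le)

text \<open>Elements with equal terms in \<open>w\<close> keep equal terms in every larger
  \<open>y\<close>, so classes grow and their minima drop. Thus \<open>class_min y d\<close> bounds
  all labels from below with which \<open>d\<close> can be absorbed by a nontrivial merge inside the
  interval.\<close>

lemma class_min_mono: 
  assumes "le w y" "d \<in> {1..n}" 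
  shows "class_min y d \<le> class_min w d"
proof (rule class_min_le)
  show "class_min w d \<in> {1..n}" using class_min_props[OF assms(2)] by blast
  show "y (class_min w d) = y d"
    using class_min_props[OF assms(2), of w] le_at[OF assms(1)] assms(2) by metis
qed

lemma the_elem_step:
  assumes "x \<in> substs" "d \<in> roots x" "t \<in> targets x d"
  shows "the_elem (roots x - roots (step x d t)) = d"
proof -
  have "roots x - roots (step x d t) = {d}" using step_roots[OF assms] assms(2) by auto
  then show ?thesis by simp
qed

lemma edge_label_step:
  assumes "x \<in> substs" "d \<in> roots x" "t \<in> targets x d"
  shows "edge_label x (step x d t) = (case t of
     Inl (e, g) \<Rightarrow> if g = \<one> then (0, d) else (2, class_min (step x d t) d)
   | Inr s \<Rightarrow> (1, if roots x = {d} \<and> least_colour x d s then 0 else idx s))"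
proof -
  have "roots (step x d t) = {} \<longleftrightarrow> roots x = {d}" using step_roots[OF assms] assms(2) by auto
  then show ?thesis
    unfolding edge_label_def Let_def the_elem_step[OF assms] step_root[OF assms(2) targets_terms[OF assms(3)]]
    by (auto split: sum.splits)
qed

lemma merge_edge:
  assumes x: "x \<in> P" and d: "d \<in> roots x" and e: "e \<in> roots x" "e < d" and g: "g \<in> carrier G"
  shows "Inl (e, g) \<in> targets x d" "edge x (step x d (Inl (e, g)))"
    "edge_label x (step x d (Inl (e, g))) = (if g = \<one> then (0, d) else (2, class_min (step x d (Inl (e, g))) d))"
proof -
  show t: "Inl (e, g) \<in> targets x d" using e g by (auto simp: targets_def)
  show "edge x (step x d (Inl (e, g)))"
    unfolding edge_def using x d t step_merge_P[OF x d t] by blast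
  show "edge_label x (step x d (Inl (e, g))) = (if g = \<one> then (0, d) else (2, class_min (step x d (Inl (e, g))) d))"
    using edge_label_step[OF P_substs[OF x] d t] by simp
qed

lemma colour_edge:
  assumes x: "x \<in> P" and d: "d \<in> roots x" and s: "s \<in> S" and p: "step x d (Inr s) \<in> P"
  shows "Inr s \<in> targets x d" "edge x (step x d (Inr s))"
    "edge_label x (step x d (Inr s)) = (1, if roots x = {d} \<and> least_colour x d s then 0 else idx s)"
    "edge_label x (step x d (Inr s)) \<le> (1, idx s)"
proof -
  show t: "Inr s \<in> targets x d" using s by (auto simp: targets_def)
  show "edge x (step x d (Inr s))" unfolding edge_def using x d t p by blast
  show l: "edge_label x (step x d (Inr s)) = (1, if roots x = {d} \<and> least_colour x d s then 0 else idx s)"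
    using edge_label_step[OF P_substs[OF x] d t] by simp
  show "edge_label x (step x d (Inr s)) \<le> (1, idx s)" unfolding l by simp
qed

lemma merge_edge_le:
  assumes x: "x \<in> P" and y: "y \<in> P" "le x y" and d: "d \<in> roots x" and e: "e \<in> roots x" "e < d"
    and g: "g \<in> carrier G" "y d = act g (y e)"
  shows "edge x (step x d (Inl (e, g)))" "le (step x d (Inl (e, g))) y"
    "edge_label x (step x d (Inl (e, g))) = (if g = \<one> then (0, d) else (2, class_min (step x d (Inl (e, g))) d))"
  using merge_edge[OF x d e g(1)] le_step_iff[OF P_substs[OF x] P_substs[OF y(1)] y(2) d] g by auto

lemma coherent_edge_le:
  assumes x: "x \<in> P" and y: "y \<in> P" "le x y" and d: "d \<in> roots x" and e: "e \<in> roots x" "e < d"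
    and g: "y d = y e"
  shows "\<exists>v. edge x v \<and> le v y \<and> edge_label x v = (0, d)"
proof -
  have "y d = act \<one> (y e)"
    using g act_one[OF substs_terms[OF P_substs[OF y(1)] rootsD(1)[OF e(1)]]] by simp
  from merge_edge_le[OF x y d e one_closed this] show ?thesis by auto
qed

lemma colour_edge_le:
  assumes x: "x \<in> P" and y: "y \<in> P" "le x y" and d: "d \<in> roots x" and s: "y d = Inr s"
    and p: "step x d (Inr s) \<in> P"
  shows "edge x (step x d (Inr s))" "le (step x d (Inr s)) y"
    "edge_label x (step x d (Inr s)) \<le> (1, idx s)"
proof -
  have "s \<in> S" using substs_Inr[OF P_substs[OF y(1)] rootsD(1)[OF d] s] .
  note * = colour_edge[OF x d this p]
  show "edge x (step x d (Inr s))" "edge_label x (step x d (Inr s)) \<le> (1, idx s)" using * by auto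
  show "le (step x d (Inr s)) y"
    using le_step_iff[OF P_substs[OF x] P_substs[OF y(1)] y(2) d *(1)] s by simp
qed

text \<open>The bound \<open>y\<close> only contributes the equation that the step has to satisfy.
  Below the adjoined top, where there is no such bound, the lemma is applied with \<open>w\<close>
  in place of \<open>y\<close>.\<close>

lemma edge_cases:
  assumes e: "edge x w" and y: "y \<in> P" "le x y" "le w y"
  obtains (coherent) d a where "d \<in> roots x" "a \<in> roots x" "a < d" "y d = y a"
      "w = step x d (Inl (a, \<one>))" "edge_label x w = (0, d)" "roots w = roots x - {d}"
    | (merge) d a g where "d \<in> roots x" "a \<in> roots x" "a < d" "g \<in> carrier G" "g \<noteq> \<one>"
      "y d = act g (y a)" "w = step x d (Inl (a, g))" "edge_label x w = (2, class_min w d)"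
      "roots w = roots x - {d}" "w d = Inl (a, g)"
    | (colour) d s where "d \<in> roots x" "s \<in> S" "y d = Inr s" "w = step x d (Inr s)"
      "edge_label x w = (1, if roots x = {d} \<and> least_colour x d s then 0 else idx s)"
      "roots w = roots x - {d}" "d \<in> colour_class w s"
proof -
  have x: "x \<in> P" and w: "w \<in> P" using e by (auto simp: edge_def)
  obtain d t where d: "d \<in> roots x" and t: "t \<in> targets x d" and wd: "w = step x d t"
    using e by (auto simp: edge_def)
  have r: "roots w = roots x - {d}" using step_roots[OF P_substs[OF x] d t] wd by simp
  have yd: "y d = app y t" using le_step_iff[OF P_substs[OF x] P_substs[OF y(1)] y(2) d t] y wd by simp
  have wt: "w d = t" using step_root[OF d targets_terms[OF t]] wd by simp
  show thesis
    using t
  proof (cases rule: targets_cases)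
    case (1 a g)
    note m = merge_edge[OF x d 1(2,3,4)]
    show ?thesis
    proof (cases "g = \<one>")
      case True
      have "y d = y a" using yd 1 True
          act_one[OF substs_terms[OF P_substs[OF y(1)] rootsD(1)[OF 1(2)]]] by simp
      then show ?thesis using coherent[of d a] d 1 r wd m True by simp
    next
      case False
      then show ?thesis using merge[of d a g] d 1 r wd m yd wt by simp
    qed
  next
    case (2 s)
    have p: "step x d (Inr s) \<in> P" using w wd 2 by simp
    have "d \<in> colour_class w s" using wt 2 rootsD(1)[OF d] by (simp add: colour_class_def)
    then show ?thesis using colour[of d s] d 2 r wd yd colour_edge(3)[OF x d 2(2) p] by simp
  qed
qed

lemma edge_le: "edge x w \<Longrightarrow> le x w"
  using le_step[OF P_substs] by (auto simp: edge_def)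

section \<open>First steps of intervals whose upper end lies in \<open>P\<close>\<close>

lemma merged_colour_P:
  assumes w: "w \<in> P" and a: "a \<in> roots w" and d: "d \<in> {1..n}" "d \<noteq> a" "w d = Inl (a, g)" and s: "s \<in> S"
  shows "step w a (Inr s) \<in> P"
  using step_colour_P[OF w a s] d by blast

text \<open>The answer to a rival that merges a block which \<open>y\<close> colours: the root
  \<open>a\<close> receiving it is coloured in \<open>y\<close> too. Its block now has at least two
  elements, so colouring it is legal, and the label of a colouring lies below every
  \<open>(2, q)\<close>.\<close>

lemma merged_colour_edge:
  assumes w: "w \<in> P" and y: "y \<in> P" "le w y" and a: "a \<in> roots w"
    and d: "d \<in> {1..n}" "d \<noteq> a" "w d = Inl (a, g)" and s: "y d = Inr s"
  shows "\<exists>v. edge w v \<and> le v y \<and> edge_label w v \<le> (2, q)"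
proof -
  have "act g (y a) = Inr s" using le_Inl[OF y(2) d(1,3)] s by simp
  then obtain s' where s': "y a = Inr s'" by (rule act_Inr_cases)
  have "s' \<in> S" using substs_Inr[OF P_substs[OF y(1)] rootsD(1)[OF a] s'] .
  from colour_edge_le[OF w y a s' merged_colour_P[OF w a d this]]
  show ?thesis using le_one_less_two order.strict_implies_order by blast
qed

text \<open>The step \<open>u\<close> merges \<open>d0\<close>, the smallest root sharing its value
  in \<open>y\<close> with a smaller root \<open>e\<close>, into \<open>e\<close>. After any rival
  that keeps both \<open>d0\<close> and \<open>e\<close> this merge is still there with label
  \<open>(0, d0)\<close>. A rival that absorbs one of the two is answered through the equation it
  leaves for the other one, which has the same value in \<open>y\<close>.\<close>

lemma first_step_coherent:
  assumes x: "x \<in> P" and y: "y \<in> P" "le x y"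
    and D: "\<exists>d\<in>roots x. \<exists>e\<in>roots x. e < d \<and> y d = y e"
  shows "\<exists>u. edge x u \<and> le u y \<and>
    (\<forall>w. edge x w \<and> le w y \<and> w \<noteq> u \<longrightarrow>
       edge_label x u < edge_label x w \<and> (\<exists>v. edge w v \<and> le v y \<and> edge_label w v \<le> edge_label x w)) \<and>
    (\<forall>v. edge u v \<and> le v y \<longrightarrow> edge_label x u < edge_label u v)"
proof -
  define D where "D = {d \<in> roots x. \<exists>e\<in>roots x. e < d \<and> y d = y e}"
  define d0 where "d0 = Min D"
  have fD: "finite D" "D \<noteq> {}" using D finite_roots by (auto simp: D_def)
  have d0D: "d0 \<in> D" and d0min: "\<And>d. d \<in> D \<Longrightarrow> d0 \<le> d"
    using Min_in[OF fD] Min_le[OF fD(1)] by (auto simp: d0_def)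
  obtain e where d0: "d0 \<in> roots x" and e: "e \<in> roots x" "e < d0" "y d0 = y e"
    using d0D by (auto simp: D_def)
  \<comment> \<open>Of two smaller roots with this value the larger one would belong to
    \<open>D\<close>, contrary to the choice of \<open>d0\<close>. So no other coherent step absorbs
    \<open>d0\<close>.\<close>
  have e_uniq: "a = e" if "a \<in> roots x" "a < d0" "y d0 = y a" for a
  proof (rule ccontr)
    assume "a \<noteq> e"
    then have "a < e \<or> e < a" by auto
    then have "e \<in> D \<or> a \<in> D" using that e by (auto simp: D_def)
    then show False using d0min[of a] d0min[of e] that e by auto
  qed
  have ye: "y d0 = act \<one> (y e)"
    using e act_one[OF substs_terms[OF P_substs[OF y(1)] rootsD(1)[OF e(1)]]] by simp
  define u where "u = step x d0 (Inl (e, \<one>))"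
  have u: "edge x u" "le u y" "edge_label x u = (0, d0)"
    using merge_edge_le[OF x y d0 e(1,2) one_closed ye] by (auto simp: u_def)
  have "edge_label x u < edge_label x w \<and> (\<exists>v. edge w v \<and> le v y \<and> edge_label w v \<le> edge_label x w)"
    if w: "edge x w" "le w y" "w \<noteq> u" for w
  proof -
    have wP: "w \<in> P" using w by (simp add: edge_def)
    show ?thesis
    proof (cases rule: edge_cases[OF w(1) y w(2), case_names coherent merge colour])
      case (coherent d a)
      have dD: "d \<in> D" using coherent by (auto simp: D_def)
      have "d \<noteq> d0" using e_uniq[of a] coherent w(3) u_def by auto
      then have lt: "d0 < d" using d0min[OF dD] by simp
      then have "d0 \<in> roots w" "e \<in> roots w" using coherent d0 e by auto
      from coherent_edge_le[OF wP y(1) w(2) this e(2,3)]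
      show ?thesis using u coherent lt by auto
    next
      case (merge d a g)
      have lt: "edge_label x u < edge_label x w" using u merge by simp
      have dn: "d \<in> {1..n}" using rootsD(1)[OF merge(1)] .
      have aw: "a \<in> roots w" using merge(2,3,9) by auto
      have "\<exists>v. edge w v \<and> le v y \<and> edge_label w v \<le> (2, class_min w d)"
      proof (cases "\<exists>s. y d = Inr s")
        case True
        then show ?thesis
          using merged_colour_edge[OF wP y(1) w(2) aw dn _ merge(10)] merge(3) by blast
      next
        case False
        consider "d \<noteq> d0" "d \<noteq> e" | "d = e" | "d = d0" by blast
        then show ?thesis
        proof cases
          case 1
          then have "d0 \<in> roots w" "e \<in> roots w" using merge d0 e by auto
          from coherent_edge_le[OF wP y(1) w(2) this e(2,3)] show ?thesis by auto
        next
          case 2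
          \<comment> \<open>Here \<open>e\<close> has been merged into \<open>a\<close> via
            \<open>g\<close>, and \<open>d0\<close> follows it with the same \<open>g\<close>. The
            resulting term already occurs at \<open>class_min w d\<close>, so the new label does not
            exceed the old one.\<close>
          then have d0w: "d0 \<in> roots w" and lt: "a < d0" using merge d0 e by auto
          have "y d0 = act g (y a)" using 2 merge e by simp
          note v = merge_edge_le[OF wP y(1) w(2) d0w aw lt merge(4) this]
          define v' where "v' = step w d0 (Inl (a, g))"
          have "v' d0 = Inl (a, g)"
            using step_root[OF d0w targets_terms[OF merge_edge(1)[OF wP d0w aw lt merge(4)]]] v'_def by simp
          moreover have "v' (class_min w d) = Inl (a, g)"
            using step_at(2)[where x = w and i = "class_min w d" and m = a and g = g and d = d0] class_min_props(1)[OF dn, of w] class_min_props(2)[OF dn, of w] merge(10) lt v'_def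
            by simp
          ultimately have "class_min v' d0 \<le> class_min w d"
            using class_min_le[of "class_min w d" v' d0] class_min_props(1)[OF dn, of w] by simp
          then show ?thesis using v merge(5) by (intro exI[of _ v']) (auto simp: v'_def)
        next
          case 3
          have yt: "y a \<in> terms" "y e \<in> terms"
            using substs_terms[OF P_substs[OF y(1)]] rootsD(1) merge(2) e(1) by auto
          have yeq: "y e = act g (y a)" using merge 3 e by simp
          have ew: "e \<in> roots w" using e 3 merge by auto
          \<comment> \<open>Otherwise \<open>g\<close> would fix the value \<open>y a\<close>, which
            is not a colour, although left multiplication on uncoloured terms is free.\<close>
          have ea: "e \<noteq> a"
          proof
            assume "e = a"
            then have yy: "y a = act g (y a)" using yeq by simp
            show False using yt(1)
            proof (cases rule: terms_cases)
              case (1 m k)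
              then show False using yy merge(4,5) r_cancel_one[of k g] by auto
            next
              case (2 s)
              then show False using False merge by auto
            qed
          qed
          show ?thesis
          proof (cases "a < e")
            case True
            note v = merge_edge_le[OF wP y(1) w(2) ew aw True merge(4) yeq]
            define v' where "v' = step w e (Inl (a, g))"
            have "v' e = Inl (a, g)"
              using step_root[OF ew targets_terms[OF merge_edge(1)[OF wP ew aw True merge(4)]]] v'_def by simp
            moreover have "v' (class_min w d) = Inl (a, g)"
              using step_at(2)[where x = w and i = "class_min w d" and m = a and g = g and d = e] class_min_props(1)[OF dn, of w] class_min_props(2)[OF dn, of w] merge(10) True v'_def
              by simp
            ultimately have "class_min v' e \<le> class_min w d"
              using class_min_le[of "class_min w d" v' e] class_min_props(1)[OF dn, of w] by simp
            then show ?thesis using v merge(5) by (intro exI[of _ v']) (auto simp: v'_def)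
          next
            case False
            \<comment> \<open>Now \<open>e\<close> has to survive, so the equation is solved for
              \<open>a\<close> with the factor \<open>inv g\<close>. The label is at most
              \<open>(2, a)\<close>, and an element whose term in \<open>w\<close> has root
              \<open>a\<close> is not smaller than \<open>a\<close>.\<close>
            then have lt: "e < a" using ea by simp
            have ya: "y a = act (inv g) (y e)" using act_inv[OF merge(4) yt(1)] yeq by simp
            have ig: "inv g \<in> carrier G" "inv g \<noteq> \<one>" using merge by auto
            note v = merge_edge_le[OF wP y(1) w(2) aw ew lt ig(1) ya]
            define v' where "v' = step w a (Inl (e, inv g))"
            have "class_min v' a \<le> a" using class_min_props(3)[OF rootsD(1)[OF aw]] .
            also have "a \<le> class_min w d"
              using substs_Inl(2)[OF P_substs[OF wP] class_min_props(1)[OF dn, of w], of a g]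
                class_min_props(2)[OF dn, of w] merge(10) by simp
            finally show ?thesis using v ig by (intro exI[of _ v']) (auto simp: v'_def)
          qed
        qed
      qed
      then show ?thesis using lt merge(8) by simp
    next
      case (colour d s)
      have lt: "edge_label x u < edge_label x w" using u colour by simp
      show ?thesis
      proof (cases "d = d0 \<or> d = e")
        case False
        then have "d0 \<in> roots w" "e \<in> roots w" using colour d0 e by auto
        from coherent_edge_le[OF wP y(1) w(2) this e(2,3)] show ?thesis using lt colour by auto
      next
        case True
        then obtain f where f: "f \<in> roots x" "f \<noteq> d" "y f = Inr s" using d0 e colour by force
        have fw: "f \<in> roots w" using f colour by simp
        have "step w f (Inr s) \<in> P" using step_colour_P[OF wP fw colour(2)] colour(7) by auto
        from colour_edge_le[OF wP y(1) w(2) fw f(3) this]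
        have "\<exists>v. edge w v \<and> le v y \<and> edge_label w v \<le> (1, idx s)" by blast
        moreover have "edge_label x w = (1, idx s)" using colour f by auto
        ultimately show ?thesis using lt by simp
      qed
    qed
  qed
  moreover have "edge_label x u < edge_label u v" if v: "edge u v" "le v y" for v
  proof -
    have ru: "roots u = roots x - {d0}"
      using step_roots[OF P_substs[OF x] d0 merge_edge(1)[OF x d0 e(1,2) one_closed]] by (simp add: u_def)
    show ?thesis
    proof (cases rule: edge_cases[OF v(1) y(1) u(2) v(2), case_names coherent merge colour])
      case (coherent d a)
      then have "d \<in> D" "d \<noteq> d0" using ru by (auto simp: D_def)
      then show ?thesis using d0min[of d] u coherent by auto
    qed (use u in auto)
  qed
  ultimately show ?thesis using u by blast
qed

text \<open>Injectivity excludes merges with factor \<open>\<one>\<close> and leaves each colour of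
  \<open>y\<close> to at most one root. By \<open>forced_colour_P\<close>, giving \<open>d0\<close>
  its colour, the one of least index, is then legal in \<open>x\<close> and still legal after every
  rival that keeps \<open>d0\<close>. If the rival has merged \<open>d0\<close> away, the receiving
  block can be coloured instead.\<close>

lemma first_step_colour:
  assumes x: "x \<in> P" and y: "y \<in> P" "le x y" and inj: "inj_on y (roots x)"
    and D: "\<exists>d\<in>roots x. \<exists>s. y d = Inr s"
  shows "\<exists>u. edge x u \<and> le u y \<and>
    (\<forall>w. edge x w \<and> le w y \<and> w \<noteq> u \<longrightarrow>
       edge_label x u < edge_label x w \<and> (\<exists>v. edge w v \<and> le v y \<and> edge_label w v \<le> edge_label x w)) \<and>
    (\<forall>v. edge u v \<and> le v y \<longrightarrow> edge_label x u < edge_label u v)"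
proof -
  obtain d0 s0 where d0: "d0 \<in> roots x" "y d0 = Inr s0"
    and min: "\<And>d s. d \<in> roots x \<Longrightarrow> y d = Inr s \<Longrightarrow> idx s0 \<le> idx s"
  proof -
    have "\<exists>k d s. d \<in> roots x \<and> y d = Inr s \<and> idx s = k" using D by blast
    from exists_least_iff[THEN iffD1, OF this] show ?thesis
      using that by (metis linorder_not_less)
  qed
  have yS: "s \<in> S" if "d \<in> roots x" "y d = Inr s" for d s
    using substs_Inr[OF P_substs[OF y(1)] rootsD(1)[OF that(1)] that(2)] .
  have strict: "idx s0 < idx s" if "d \<in> roots x" "d \<noteq> d0" "y d = Inr s" for d s
  proof -
    have "s \<noteq> s0" using inj that d0 by (auto simp: inj_on_def)
    then have "idx s \<noteq> idx s0" using idx_inj yS d0 that by (auto simp: inj_on_def)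
    then show ?thesis using min[OF that(1,3)] by simp
  qed
  have colour_P: "step w d0 (Inr s0) \<in> P"
    if "w \<in> P" "le w y" "roots w \<subseteq> roots x" "d0 \<in> roots w" for w
  proof (rule forced_colour_P[OF that(1) y(1) that(2,4) d0(2)])
    show "a = d0" if "a \<in> roots w" "y a = Inr s0" for a
      using inj_onD[OF inj, of a d0] that \<open>roots w \<subseteq> roots x\<close> d0 by auto
  qed
  have no_coh: False if "d \<in> roots x" "a \<in> roots x" "a < d" "y d = y a" for d a
    using inj_onD[OF inj, of d a] that by auto
  define u where "u = step x d0 (Inr s0)"
  have uP: "u \<in> P" using colour_P[OF x y(2) _ d0(1)] by (simp add: u_def)
  have u: "edge x u" "le u y" "edge_label x u \<le> (1, idx s0)"
    using colour_edge_le[OF x y d0] uP by (auto simp: u_def)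
  have ru: "roots u = roots x - {d0}"
    using step_roots[OF P_substs[OF x] d0(1) colour_edge(1)[OF x d0(1) yS[OF d0]]] uP by (simp add: u_def)
  have "edge_label x u < edge_label x w \<and> (\<exists>v. edge w v \<and> le v y \<and> edge_label w v \<le> edge_label x w)"
    if w: "edge x w" "le w y" "w \<noteq> u" for w
  proof -
    have wP: "w \<in> P" using w by (simp add: edge_def)
    show ?thesis
    proof (cases rule: edge_cases[OF w(1) y w(2), case_names coherent merge colour])
      case (coherent d a)
      then show ?thesis using no_coh by blast
    next
      case (merge d a g)
      have lt: "edge_label x u < edge_label x w" unfolding merge(8) using u(3) by (rule le_one_less_two)
      have dn: "d \<in> {1..n}" using rootsD(1)[OF merge(1)] .
      have aw: "a \<in> roots w" using merge(2,3,9) by auto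
      have "\<exists>v. edge w v \<and> le v y \<and> edge_label w v \<le> (2, class_min w d)"
      proof (cases "d = d0")
        case True
        then show ?thesis
          using merged_colour_edge[OF wP y(1) w(2) aw dn _ merge(10)] merge(3) d0 by blast
      next
        case False
        then have d0w: "d0 \<in> roots w" using d0 merge by simp
        from colour_edge_le[OF wP y(1) w(2) d0w d0(2) colour_P[OF wP w(2) _ d0w]] merge(9)
        have "edge w (step w d0 (Inr s0)) \<and> le (step w d0 (Inr s0)) y \<and> edge_label w (step w d0 (Inr s0)) \<le> (1, idx s0)"
          by blast
        then show ?thesis using le_one_less_two order.strict_implies_order by blast
      qed
      then show ?thesis using lt merge(8) by simp
    next
      case (colour d s)
      have dd: "d \<noteq> d0" using colour(3,4) w(3) d0(2) u_def by force
      then have "roots x \<noteq> {d}" using d0(1) by auto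
      then have l: "edge_label x w = (1, idx s)" using colour(5) by simp
      have s: "idx s0 < idx s" using strict[OF colour(1) dd colour(3)] .
      have d0w: "d0 \<in> roots w" using d0(1) colour(6) dd by simp
      from colour_edge_le[OF wP y(1) w(2) d0w d0(2) colour_P[OF wP w(2) _ d0w]] colour(6)
      have "edge w (step w d0 (Inr s0)) \<and> le (step w d0 (Inr s0)) y \<and> edge_label w (step w d0 (Inr s0)) \<le> (1, idx s0)"
        by blast
      moreover have "(1, idx s0) < (1 :: nat, idx s)" using s by simp
      ultimately show ?thesis unfolding l using u(3)
        by (meson order.strict_trans1 order.strict_implies_order order.trans)
    qed
  qed
  moreover have "edge_label x u < edge_label u v" if v: "edge u v" "le v y" for v
  proof (cases rule: edge_cases[OF v(1) y(1) u(2) v(2), case_names coherent merge colour])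
    case (coherent d a)
    then show ?thesis using no_coh ru by blast
  next
    case (merge d a g)
    show ?thesis unfolding merge(8) using u(3) by (rule le_one_less_two)
  next
    case (colour d s)
    have dx: "d \<in> roots x" "d \<noteq> d0" using colour(1) ru by auto
    have lt: "idx s0 < idx s" using strict[OF dx colour(3)] .
    \<comment> \<open>The exceptional value \<open>0\<close> must not spoil the rise after
      \<open>u\<close>. As \<open>s0\<close> occurs in \<open>u\<close>, it is a legal colour for
      \<open>d\<close>, and it has smaller index than \<open>s\<close>; so \<open>s\<close> is not
      the least legal colour and its label is the regular one.\<close>
    have "d0 \<in> colour_class u s0"
      using step_root[OF d0(1), of "Inr s0"] yS[OF d0] rootsD(1)[OF d0(1)] by (simp add: u_def colour_class_def)
    then have "step u d (Inr s0) \<in> P" using step_colour_P[OF uP colour(1) yS[OF d0]] by auto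
    then have "\<not> least_colour u d s" using lt yS[OF d0] by (auto simp: least_colour_def not_le)
    then have "edge_label u v = (1, idx s)" using colour(5) by simp
    moreover have "(1, idx s0) < (1 :: nat, idx s)" using lt by simp
    ultimately show ?thesis using u(3) by (metis order.strict_trans1)
  qed
  ultimately show ?thesis using u by blast
qed

text \<open>Only merges with nontrivial factor remain. Absorbing \<open>d\<close> costs at least
  \<open>(2, class_min y d)\<close>, and these bounds differ for different lost roots by
  injectivity. The root \<open>d0\<close> has the least bound, and merging it directly into its
  final root \<open>m\<close> attains it.\<close>

lemma first_step_merge:
  assumes x: "x \<in> P" and y: "y \<in> P" "le x y" "x \<noteq> y" and inj: "inj_on y (roots x)"
    and D: "\<And>d s. d \<in> roots x \<Longrightarrow> y d \<noteq> Inr s"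
  shows "\<exists>u. edge x u \<and> le u y \<and>
    (\<forall>w. edge x w \<and> le w y \<and> w \<noteq> u \<longrightarrow>
       edge_label x u < edge_label x w \<and> (\<exists>v. edge w v \<and> le v y \<and> edge_label w v \<le> edge_label x w)) \<and>
    (\<forall>v. edge u v \<and> le v y \<longrightarrow> edge_label x u < edge_label u v)"
proof -
  note xs = P_substs[OF x] and ys = P_substs[OF y(1)]
  have ryx: "roots y \<subset> roots x" using le_roots_psubset[OF xs ys y(2,3)] .
  obtain d0 where d0: "d0 \<in> roots x" "d0 \<notin> roots y"
    and min: "\<And>d. d \<in> roots x \<Longrightarrow> d \<notin> roots y \<Longrightarrow> class_min y d0 \<le> class_min y d"
  proof -
    have "\<exists>k d. d \<in> roots x \<and> d \<notin> roots y \<and> class_min y d = k" using ryx by blast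
    from exists_least_iff[THEN iffD1, OF this] show ?thesis
      using that by (metis linorder_not_less)
  qed
  have d0n: "d0 \<in> {1..n}" using rootsD(1)[OF d0(1)] .
  have strict: "class_min y d0 < class_min y d" if "d \<in> roots x" "d \<notin> roots y" "d \<noteq> d0" for d
  proof -
    have "y d \<noteq> y d0" using inj_onD[OF inj, of d d0] that d0 by auto
    then have "class_min y d \<noteq> class_min y d0"
      using class_min_props(2)[OF d0n, of y] class_min_props(2)[OF rootsD(1)[OF that(1)], of y] by metis
    then show ?thesis using min[OF that(1,2)] by simp
  qed
  obtain m g0 where yd0: "y d0 = Inl (m, g0)" using D[OF d0(1)] by (metis old.sum.exhaust surj_pair)
  have m: "m \<in> roots y" "m \<le> d0" and g0: "g0 \<in> carrier G" using substs_Inl[OF ys d0n yd0] by auto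
  have mx: "m \<in> roots x" using m ryx by auto
  have md0: "m < d0" using m d0 by (metis nat_less_le)
  have ym: "y m = Inl (m, \<one>)" using rootsD(2)[OF m(1)] .
  have no_coh: False if "d \<in> roots x" "a \<in> roots x" "a < d" "y d = y a" for d a
    using inj_onD[OF inj, of d a] that by auto
  have g01: "g0 \<noteq> \<one>" using no_coh[OF d0(1) mx md0] yd0 ym by auto
  have yy: "y d0 = act g0 (y m)" using yd0 ym g0 by simp
  define q where "q = class_min y d0"
  have qn: "q \<in> {1..n}" "y q = Inl (m, g0)" using class_min_props[OF d0n, of y] yd0 by (auto simp: q_def)
  \<comment> \<open>This is why \<open>u\<close> attains the bound: \<open>q\<close> already carries
    the term of \<open>d0\<close> in \<open>u\<close>. If the root of \<open>q\<close> in
    \<open>x\<close> is lost in \<open>y\<close>, the minimal choice of \<open>d0\<close> makes this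
    root equal to \<open>q\<close>, and injectivity makes it equal to \<open>d0\<close>.\<close>
  have xq: "x q = Inl (m, g0) \<or> q = d0"
    using substs_terms[OF xs qn(1)]
  proof (cases rule: terms_cases)
    case (1 a k)
    have a: "a \<in> roots x" "a \<le> q" using substs_Inl[OF xs qn(1) 1(1)] by auto
    have ya: "act k (y a) = Inl (m, g0)" using le_Inl[OF y(2) qn(1) 1(1)] qn by simp
    then obtain h where h: "y a = Inl (m, h)" "g0 = k \<otimes> h" by (rule act_Inl_cases)
    show ?thesis
    proof (cases "a \<in> roots y")
      case True
      then have "m = a" "h = \<one>" using rootsD(2)[OF True] h by auto
      then show ?thesis using h 1 by simp
    next
      case False
      have "q \<le> class_min y a" using min[OF a(1) False] q_def by simp
      also have "class_min y a \<le> a" using class_min_props(3)[OF 1(2)] .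
      finally have "a = q" using a by simp
      then have "a = d0" using inj_onD[OF inj, of a d0] qn yd0 a d0 by auto
      then show ?thesis using \<open>a = q\<close> by simp
    qed
  next
    case (2 s)
    then show ?thesis using le_Inr[OF y(2) qn(1) 2(1)] qn by simp
  qed
  have step_q: "step w d0 (Inl (m, g0)) q = Inl (m, g0)"
    if "d0 \<in> roots w" "x q = Inl (m, g0) \<Longrightarrow> w q = Inl (m, g0)" for w
    using xq
  proof
    assume "x q = Inl (m, g0)"
    then show ?thesis using step_at(2)[where x = w, OF qn(1)] that(2) md0 by auto
  next
    assume "q = d0"
    then show ?thesis using step_root[OF that(1), of "Inl (m, g0)"] rootsD(1)[OF mx] g0 by auto
  qed
  have class_min_step: "class_min (step w d0 (Inl (m, g0))) d0 \<le> q"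
    if "d0 \<in> roots w" "x q = Inl (m, g0) \<Longrightarrow> w q = Inl (m, g0)" for w
    using class_min_le[OF qn(1), of "step w d0 (Inl (m, g0))" d0] step_q[OF that]
      step_root[OF that(1), of "Inl (m, g0)"] rootsD(1)[OF mx] g0 by auto
  define u where "u = step x d0 (Inl (m, g0))"
  have u: "edge x u" "le u y" "edge_label x u = (2, class_min u d0)"
    using merge_edge_le[OF x y(1,2) d0(1) mx md0 g0 yy] g01 by (auto simp: u_def)
  have ucls: "class_min u d0 = q"
    using class_min_step[OF d0(1)] class_min_mono[OF u(2) d0n] by (simp add: u_def q_def)
  have lu: "edge_label x u = (2, q)" using u ucls by simp
  have ru: "roots u = roots x - {d0}"
    using step_roots[OF xs d0(1) merge_edge(1)[OF x d0(1) mx md0 g0]] by (simp add: u_def)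
  have not_root: "d \<notin> roots y" if "d \<in> roots x" "a < d" "y d = act g (y a)" "a \<in> roots x" for d a g
  proof
    assume "d \<in> roots y"
    then have "act g (y a) = Inl (d, \<one>)" using rootsD(2) that by metis
    then obtain h where "y a = Inl (d, h)" by (rule act_Inl_cases)
    then show False using substs_Inl(2)[OF ys rootsD(1)[OF that(4)]] that(2) by fastforce
  qed
  have "edge_label x u < edge_label x w \<and> (\<exists>v. edge w v \<and> le v y \<and> edge_label w v \<le> edge_label x w)"
    if w: "edge x w" "le w y" "w \<noteq> u" for w
  proof -
    have wP: "w \<in> P" using w by (simp add: edge_def)
    show ?thesis
    proof (cases rule: edge_cases[OF w(1) y(1,2) w(2), case_names coherent merge colour])
      case (coherent d a)
      then show ?thesis using no_coh by blast
    next
      case (colour d s)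
      then show ?thesis using D by blast
    next
      case (merge d a g)
      have dn: "d \<in> {1..n}" using rootsD(1)[OF merge(1)] .
      have dy: "d \<notin> roots y" using not_root[OF merge(1,3,6,2)] .
      have aw: "a \<in> roots w" using merge(2,3,9) by auto
      have wc: "class_min w d \<in> {1..n}" "w (class_min w d) = Inl (a, g)"
        using class_min_props[OF dn, of w] merge(10) by auto
      have acls: "a < class_min w d"
      proof -
        have "a \<le> class_min w d" using substs_Inl(2)[OF P_substs[OF wP] wc] .
        moreover have "a \<noteq> class_min w d" using wc(2) rootsD(2)[OF aw] merge(5) by auto
        ultimately show ?thesis by simp
      qed
      have lt: "q < class_min w d"
      proof (cases "d = d0")
        case False
        then show ?thesis using strict[OF merge(1) dy] class_min_mono[OF w(2) dn] by (simp add: q_def)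
      next
        case True
        \<comment> \<open>A rival that merges \<open>d0\<close> into some \<open>a\<close> other
          than its final root: then \<open>a\<close> is itself lost in \<open>y\<close>, so
          \<open>q\<close> is at most \<open>a\<close> by minimality, and \<open>a\<close> is
          smaller than \<open>class_min w d\<close>.\<close>
        have am: "a \<noteq> m"
        proof
          assume "a = m"
          then have "act g (y m) = act g0 (y m)" using merge(6) True yy by simp
          then have "g = g0" using ym merge(4) g0 by simp
          then show False using w(3) merge(7) True \<open>a = m\<close> u_def by simp
        qed
        have ay: "a \<notin> roots y"
        proof
          assume "a \<in> roots y"
          then have "y a = Inl (a, \<one>)" by (rule rootsD(2))
          then show False using merge(6) True yd0 am by simp
        qed
        have "q < a \<or> q \<le> class_min y a \<and> class_min y a \<le> a"
          using min[OF merge(2) ay] class_min_props(3)[OF rootsD(1)[OF merge(2)], of y] by (simp add: q_def)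
        then show ?thesis using acls by auto
      qed
      have l: "edge_label x u < edge_label x w" using lt lu merge(8) by simp
      \<comment> \<open>If \<open>a\<close> is lost in \<open>y\<close>, sending it to its final
        root costs at most \<open>(2, a)\<close>. If \<open>a\<close> survives, then
        \<open>d\<close> is not \<open>d0\<close>, since \<open>w\<close> is not \<open>u\<close>,
        and the intended merge of \<open>d0\<close> into \<open>m\<close> is still
        available.\<close>
      have "\<exists>v. edge w v \<and> le v y \<and> edge_label w v \<le> (2, class_min w d)"
      proof (cases "a \<in> roots y")
        case False
        obtain m' k where ya: "y a = Inl (m', k)" using D[OF merge(2)] by (metis old.sum.exhaust surj_pair)
        have an: "a \<in> {1..n}" using rootsD(1)[OF aw] .
        have m': "m' \<in> roots y" "m' \<le> a" "k \<in> carrier G" using substs_Inl[OF ys an ya] by auto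
        have m'a: "m' < a" using m' False by (metis nat_less_le)
        have m'w: "m' \<in> roots w" using m' ryx merge(9) dy by auto
        have "y a = act k (y m')" using ya rootsD(2)[OF m'(1)] m' by simp
        note v = merge_edge_le[OF wP y(1) w(2) aw m'w m'a m'(3) this]
        have "class_min (step w a (Inl (m', k))) a \<le> a" using class_min_props(3)[OF an] .
        then show ?thesis using v acls
          by (intro exI[of _ "step w a (Inl (m', k))"]) auto
      next
        case True
        have "y d = Inl (a, g)" using merge(4,6) rootsD(2)[OF True] by simp
        then have dd0: "d \<noteq> d0" using yd0 w(3) merge(7) u_def by auto
        have d0w: "d0 \<in> roots w" and mw: "m \<in> roots w" using d0 mx merge(9) dd0 dy m by auto
        have md: "m \<noteq> d" using dy m by auto
        note v = merge_edge_le[OF wP y(1) w(2) d0w mw md0 g0 yy]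
        have "w q = Inl (m, g0)" if "x q = Inl (m, g0)"
          using step_at(2)[where x = x, OF qn(1) that] merge(7) md by simp
        from class_min_step[OF d0w this] show ?thesis using v g01 lt
          by (intro exI[of _ "step w d0 (Inl (m, g0))"]) auto
      qed
      then show ?thesis using l merge(8) by simp
    qed
  qed
  moreover have "edge_label x u < edge_label u v" if v: "edge u v" "le v y" for v
  proof (cases rule: edge_cases[OF v(1) y(1) u(2) v(2), case_names coherent merge colour])
    case (coherent d a)
    then show ?thesis using no_coh ru by blast
  next
    case (colour d s)
    then show ?thesis using D ru by blast
  next
    case (merge d a g)
    have dx: "d \<in> roots x" "d \<noteq> d0" "a \<in> roots x" using merge(1,2) ru by auto
    have "class_min y d0 < class_min y d" using strict[OF dx(1) not_root[OF dx(1) merge(3,6) dx(3)] dx(2)] .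
    also have "\<dots> \<le> class_min v d" using class_min_mono[OF v(2) rootsD(1)[OF dx(1)]] .
    finally show ?thesis using lu merge(8) by (simp add: q_def)
  qed
  ultimately show ?thesis using u by blast
qed

lemma first_step_le:
  assumes x: "x \<in> P" and y: "y \<in> P" "le x y" "x \<noteq> y"
  shows "\<exists>u. edge x u \<and> le u y \<and>
    (\<forall>w. edge x w \<and> le w y \<and> w \<noteq> u \<longrightarrow>
       edge_label x u < edge_label x w \<and> (\<exists>v. edge w v \<and> le v y \<and> edge_label w v \<le> edge_label x w)) \<and>
    (\<forall>v. edge u v \<and> le v y \<longrightarrow> edge_label x u < edge_label u v)"
proof (cases "inj_on y (roots x)")
  case True
  then show ?thesis
    using first_step_colour[OF x y(1,2) True] first_step_merge[OF x y True] by blast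
next
  case False
  then have "\<exists>d\<in>roots x. \<exists>e\<in>roots x. e < d \<and> y d = y e"
    unfolding inj_on_def by (metis linorder_neqE_nat)
  then show ?thesis using first_step_coherent[OF x y(1,2)] by blast
qed

section \<open>Intervals ending at the adjoined top\<close>

lemma first_step_top_many:
  assumes x: "x \<in> P" and e: "e \<in> roots x" "\<And>a. a \<in> roots x \<Longrightarrow> e \<le> a"
    and d0: "d0 \<in> roots x" "d0 \<noteq> e" "\<And>a. a \<in> roots x \<Longrightarrow> a \<noteq> e \<Longrightarrow> d0 \<le> a"
  shows "\<exists>u. edge x u \<and>
    (\<forall>w. edge x w \<and> w \<noteq> u \<longrightarrow> edge_label x u < edge_label x w \<and> (\<exists>v. edge w v \<and> edge_label w v \<le> edge_label x w)) \<and>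
    (\<forall>v. edge u v \<longrightarrow> edge_label x u < edge_label u v) \<and> roots u \<noteq> {}"
proof -
  have ed: "e < d0" using e d0 by (metis le_neq_implies_less)
  \<comment> \<open>No upper bound imposes equations here, so all blocks may be merged with factor
    \<open>\<one>\<close>. The least root cannot be absorbed by a merge, hence
    \<open>(0, d0)\<close> with the second smallest root is the least possible label. A rival is
    answered by a merge with factor \<open>\<one>\<close>, or by a colouring if it leaves a single
    block.\<close>
  define u where "u = step x d0 (Inl (e, \<one>))"
  have u: "edge x u" "edge_label x u = (0, d0)" "roots u = roots x - {d0}"
    using merge_edge[OF x d0(1) e(1) ed one_closed]
      step_roots[OF P_substs[OF x] d0(1) merge_edge(1)[OF x d0(1) e(1) ed one_closed]]
    by (auto simp: u_def)
  have coh: "\<exists>v. edge w v \<and> fst (edge_label w v) = 0" if "w \<in> P" "a \<in> roots w" "b \<in> roots w" "a < b" for w a b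
    using merge_edge[OF that(1,3,2,4) one_closed] by (metis fst_conv)
  have "edge_label x u < edge_label x w \<and> (\<exists>v. edge w v \<and> edge_label w v \<le> edge_label x w)" if w: "edge x w" "w \<noteq> u" for w
  proof -
    have wP: "w \<in> P" using w by (simp add: edge_def)
    note ww = edge_le[OF w(1)] le_refl[OF P_substs[OF wP]]
    show ?thesis
    proof (cases rule: edge_cases[OF w(1) wP ww, case_names coherent merge colour])
      case (coherent d a)
      have de: "d \<noteq> e" using coherent(2,3) e(2)[of a] by auto
      have "d \<noteq> d0"
      proof
        assume "d = d0"
        then have "a = e" using coherent(2,3) d0(3)[of a] by auto
        then show False using \<open>d = d0\<close> coherent(5) w(2) u_def by simp
      qed
      then have lt: "d0 < d" using d0(3)[OF coherent(1) de] by simp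
      have "d0 \<in> roots w" "e \<in> roots w" using d0 e de lt coherent(7) by auto
      from merge_edge[OF wP this ed one_closed] lt show ?thesis
        unfolding coherent(6) u(2) by (intro conjI exI[of _ "step w d0 (Inl (e, \<one>))"]) auto
    next
      case (merge d a g)
      have aw: "a \<in> roots w" using merge(2,3,9) by auto
      have "\<exists>v. edge w v \<and> fst (edge_label w v) < 2"
      proof (cases "roots w = {a}")
        case True
        \<comment> \<open>The only block left contains both \<open>a\<close> and \<open>d\<close>,
          so every colour is legal for it.\<close>
        obtain s where s: "s \<in> S" using S_ne by auto
        have "step w a (Inr s) \<in> P"
          using merged_colour_P[OF wP aw rootsD(1)[OF merge(1)] _ merge(10) s] merge(3) by simp
        from colour_edge(2,3)[OF wP aw s this] show ?thesis by (metis fst_conv one_less_numeral_iff semiring_norm(76))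
      next
        case False
        then obtain b where "b \<in> roots w" "b \<noteq> a" using aw by auto
        then show ?thesis using coh[OF wP, of a b] coh[OF wP, of b a] aw
          by (metis linorder_neqE_nat zero_less_numeral)
      qed
      then obtain v where v: "edge w v" "fst (edge_label w v) < 2" by blast
      then have "edge_label w v \<le> (2, class_min w d)" by (cases "edge_label w v") auto
      then show ?thesis unfolding merge(8) u(2) using v by auto
    next
      case (colour d s)
      have nd: "roots x \<noteq> {d}" using e(1) d0(1,2) by auto
      then have l: "edge_label x w = (1, idx s)" using colour(5) by simp
      obtain b where b: "b \<in> roots w" using nd colour(1,6) by auto
      have "\<exists>v. edge w v \<and> edge_label w v \<le> (1, idx s)"
      proof (cases "roots w = {b}")
        case True
        have "step w b (Inr s) \<in> P" using step_colour_P[OF wP b colour(2)] colour(7) by auto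
        then show ?thesis using colour_edge(2,4)[OF wP b colour(2)] by blast
      next
        case False
        then obtain a where "a \<in> roots w" "a \<noteq> b" using b by auto
        then obtain v where v: "edge w v" "fst (edge_label w v) = 0"
          using coh[OF wP, of a b] coh[OF wP, of b a] b by (metis linorder_neqE_nat)
        then have "edge_label w v \<le> (1, idx s)" by (cases "edge_label w v") auto
        then show ?thesis using v by blast
      qed
      then show ?thesis unfolding l u(2) by auto
    qed
  qed
  moreover have "edge_label x u < edge_label u v" if v: "edge u v" for v
  proof -
    have vP: "v \<in> P" using v by (simp add: edge_def)
    show ?thesis
    proof (cases rule: edge_cases[OF v vP edge_le[OF v] le_refl[OF P_substs[OF vP]],
          case_names coherent merge colour])
      case (coherent d a)
      have "d \<noteq> e" using coherent(2,3) e(2)[of a] u(3) by auto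
      then have "d0 < d" using d0(3)[of d] coherent(1) u(3) by (auto simp: nat_less_le)
      then show ?thesis unfolding coherent(6) u(2) by simp
    next
      case (merge d a g)
      show ?thesis unfolding merge(8) u(2) by simp
    next
      case (colour d s)
      show ?thesis unfolding colour(5) u(2) by simp
    qed
  qed
  moreover have "roots u \<noteq> {}" using u(3) e(1) d0(2) by auto
  ultimately show ?thesis using u(1) by blast
qed

text \<open>Exactly one colouring of the last block may rise to the label \<open>(1, 1)\<close> of
  the step to the top. The legal colour of least index has the label \<open>(1, 0)\<close>; every
  other legal colour has a strictly larger index, hence at least 1, and its label does not lie below
  \<open>(1, 1)\<close>.\<close>

lemma first_step_top_single:
  assumes x: "x \<in> P" and d: "roots x = {d}"
  shows "\<exists>u. edge x u \<and> roots u = {} \<and> edge_label x u < (1, 1) \<and>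
    (\<forall>w. edge x w \<and> w \<noteq> u \<longrightarrow> edge_label x u < edge_label x w \<and> roots w = {} \<and> (1, 1) \<le> edge_label x w)"
proof -
  have dx: "d \<in> roots x" using d by simp
  have dn: "d \<in> {1..n}" using rootsD(1)[OF dx] .
  have "\<exists>s\<in>S. step x d (Inr s) \<in> P"
  proof -
    \<comment> \<open>This is where 2 \<le> \<open>n\<close> enters. An element other than
      \<open>d\<close> lies in the block of \<open>d\<close>, which makes every colour legal, or is
      coloured already, which makes its own colour legal.\<close>
    define j :: nat where "j = (if d = 1 then 2 else 1)"
    have j: "j \<in> {1..n}" "j \<noteq> d" using n2 by (auto simp: j_def)
    show ?thesis
      using substs_terms[OF P_substs[OF x] j(1)]
    proof (cases rule: terms_cases)
      case (1 m g)
      have "m = d" using substs_Inl(1)[OF P_substs[OF x] j(1) 1(1)] d by simp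
      then show ?thesis using step_colour_P[OF x dx] S_ne j 1(1) by blast
    next
      case (2 s)
      then have "j \<in> colour_class x s" using j by (simp add: colour_class_def)
      then show ?thesis using step_colour_P[OF x dx 2(2)] 2(2) by blast
    qed
  qed
  then have "\<exists>k. \<exists>s\<in>S. step x d (Inr s) \<in> P \<and> idx s = k" by blast
  from exists_least_iff[THEN iffD1, OF this] obtain s0 where s0: "s0 \<in> S" "step x d (Inr s0) \<in> P"
    and min: "\<And>s. s \<in> S \<Longrightarrow> step x d (Inr s) \<in> P \<Longrightarrow> idx s0 \<le> idx s"
    by (metis linorder_not_less)
  define u where "u = step x d (Inr s0)"
  have lc: "least_colour x d s0" using min by (auto simp: least_colour_def)
  note c = colour_edge[OF x dx s0]
  have u: "edge x u" "edge_label x u = (1, 0)" "roots u = {}"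
    using c(2,3) d lc step_roots[OF P_substs[OF x] dx c(1)] by (auto simp: u_def)
  have "edge_label x u < edge_label x w \<and> roots w = {} \<and> (1, 1) \<le> edge_label x w" if w: "edge x w" "w \<noteq> u" for w
  proof -
    have wP: "w \<in> P" using w by (simp add: edge_def)
    show ?thesis
    proof (cases rule: edge_cases[OF w(1) wP edge_le[OF w(1)] le_refl[OF P_substs[OF wP]],
          case_names coherent merge colour])
      case (coherent b a)
      then show ?thesis using d by auto
    next
      case (merge b a g)
      then show ?thesis using d by auto
    next
      case (colour b s)
      have b: "b = d" using colour(1) d by simp
      have p: "step x d (Inr s) \<in> P" using wP colour(4) b by simp
      have "s \<noteq> s0" using colour(4) b w(2) u_def by auto
      then have "idx s \<noteq> idx s0" using inj_onD[OF idx_inj, of s s0] colour(2) s0(1) by auto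
      then have lt: "idx s0 < idx s" using min[OF colour(2) p] by simp
      then have "\<not> least_colour x d s" using s0 by (auto simp: least_colour_def)
      then have "edge_label x w = (1, idx s)" using colour(5) b by simp
      then show ?thesis using lt u(2) colour(6) d b by auto
    qed
  qed
  then show ?thesis using u by auto
qed

section \<open>The poset of substitutions with adjoined top\<close>

definition model_order :: "(nat \<Rightarrow> nat \<times> 'a + 's) rel" where
  "model_order = {(x, y). x \<in> P \<and> y \<in> P \<and> le x y}"

text \<open>The top covers just the elements without blocks, since by \<open>first_step_top\<close>
  an element of \<open>P\<close> with a root always admits a further step inside
  \<open>P\<close>.\<close>

fun top_edge :: "(nat \<Rightarrow> nat \<times> 'a + 's) option \<Rightarrow> (nat \<Rightarrow> nat \<times> 'a + 's) option \<Rightarrow> bool" where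
  "top_edge (Some x) (Some y) = edge x y"
| "top_edge (Some x) None = (x \<in> P \<and> roots x = {})"
| "top_edge None y = False"

fun top_rank :: "(nat \<Rightarrow> nat \<times> 'a + 's) option \<Rightarrow> nat" where
  "top_rank (Some x) = n - card (roots x)"
| "top_rank None = Suc n"

fun top_label :: "(nat \<Rightarrow> nat \<times> 'a + 's) option \<times> (nat \<Rightarrow> nat \<times> 'a + 's) option \<Rightarrow> nat \<times> nat" where
  "top_label (Some x, Some y) = edge_label x y"
| "top_label (p, q) = (1, 1)"

lemma Field_model_order: "Field model_order = P"
  using le_refl[OF P_substs] by (auto simp: model_order_def Field_def)

lemma adjoin_top_model_iff [simp]:
  "(Some x, Some y) \<in> adjoin_top model_order \<longleftrightarrow> x \<in> P \<and> y \<in> P \<and> le x y"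
  "(Some x, None) \<in> adjoin_top model_order \<longleftrightarrow> x \<in> P"
  "(None, Some y) \<in> adjoin_top model_order \<longleftrightarrow> False"
  "(None, None) \<in> adjoin_top model_order \<longleftrightarrow> True"
  unfolding adjoin_top_def Field_model_order by (auto simp: model_order_def)

lemma Field_adjoin_top_model: "Field (adjoin_top model_order) = insert None (Some ` P)"
proof
  show "Field (adjoin_top model_order) \<subseteq> insert None (Some ` P)"
    unfolding adjoin_top_def Field_model_order by (auto simp: model_order_def Field_def)
  show "insert None (Some ` P) \<subseteq> Field (adjoin_top model_order)"
    using FieldI1[OF adjoin_top_model_iff(2)[THEN iffD2]] FieldI1[OF adjoin_top_model_iff(4)[THEN iffD2]]
    by blast
qed

lemma Partial_order_model: "Partial_order (adjoin_top model_order)"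
  unfolding order_on_defs Field_adjoin_top_model
proof (intro conjI)
  show "adjoin_top model_order \<subseteq> insert None (Some ` P) \<times> insert None (Some ` P)"
    using Field_adjoin_top_model by (auto simp: Field_def)
  show "refl_on (insert None (Some ` P)) (adjoin_top model_order)"
    using le_refl[OF P_substs] by (auto simp: refl_on_def)
  show "trans (adjoin_top model_order)"
  proof (rule transI)
    fix a b c assume *: "(a, b) \<in> adjoin_top model_order" "(b, c) \<in> adjoin_top model_order"
    show "(a, c) \<in> adjoin_top model_order"
    proof (cases a; cases b; cases c)
      fix x y z assume "a = Some x" "b = Some y" "c = Some z"
      then show ?thesis using * le_trans[of x y z] P_substs by simp
    qed (use * in auto)
  qed
  show "antisym (adjoin_top model_order)"
  proof (rule antisymI)
    fix a b assume *: "(a, b) \<in> adjoin_top model_order" "(b, a) \<in> adjoin_top model_order"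
    show "a = b"
    proof (cases a; cases b)
      fix x y assume "a = Some x" "b = Some y"
      then show ?thesis using * le_antisym[of x y] P_substs by simp
    qed (use * in auto)
  qed
qed

lemma card_roots: "card (roots x) \<le> n"
  using card_mono[of "{1..n}" "roots x"] rootsD(1) by fastforce

lemma first_step_top:
  assumes x: "x \<in> P" and r: "roots x \<noteq> {}"
  shows "\<exists>u. edge x u \<and>
    (\<forall>w. edge x w \<and> w \<noteq> u \<longrightarrow> edge_label x u < edge_label x w \<and>
       ((\<exists>v. edge w v \<and> edge_label w v \<le> edge_label x w) \<or> roots w = {} \<and> (1, 1) \<le> edge_label x w)) \<and>
    (\<forall>v. edge u v \<longrightarrow> edge_label x u < edge_label u v) \<and> (roots u = {} \<longrightarrow> edge_label x u < (1, 1))"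
proof (cases "\<exists>d. roots x = {d}")
  case True
  then obtain d where "roots x = {d}" by blast
  from first_step_top_single[OF x this] obtain u where u: "edge x u" "roots u = {}" "edge_label x u < (1, 1)"
    "\<forall>w. edge x w \<and> w \<noteq> u \<longrightarrow> edge_label x u < edge_label x w \<and> roots w = {} \<and> (1, 1) \<le> edge_label x w" by blast
  have "\<not> edge u v" for v using u(2) by (simp add: edge_def)
  then show ?thesis using u by (intro exI[of _ u]) simp
next
  case False
  define e where "e = Min (roots x)"
  have e: "e \<in> roots x" "\<And>a. a \<in> roots x \<Longrightarrow> e \<le> a"
    using Min_in[OF finite_roots r] Min_le[OF finite_roots] by (auto simp: e_def)
  have ne: "roots x - {e} \<noteq> {}" using False e(1) by auto
  have fin: "finite (roots x - {e})" using finite_roots by simp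
  define d where "d = Min (roots x - {e})"
  have d: "d \<in> roots x" "d \<noteq> e" "\<And>a. a \<in> roots x \<Longrightarrow> a \<noteq> e \<Longrightarrow> d \<le> a"
    using Min_in[OF fin ne] Min_le[OF fin] by (auto simp: d_def)
  show ?thesis using first_step_top_many[OF x e d] by blast
qed

lemma local_EL_model: "local_EL (adjoin_top model_order) top_edge top_rank top_label"
proof
  show "Partial_order (adjoin_top model_order)" by (rule Partial_order_model)
next
  fix a b assume "top_edge a b"
  then show "(a, b) \<in> adjoin_top model_order"
    by (cases a; cases b) (auto simp: edge_le, auto simp: edge_def)
next
  fix a b assume e: "top_edge a b"
  show "top_rank b = Suc (top_rank a)"
  proof (cases a; cases b)
    fix x y assume ab: "a = Some x" "b = Some y"
    then have exy: "edge x y" using e by simp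
    then obtain d t where d: "x \<in> P" "d \<in> roots x" "t \<in> targets x d" "y = step x d t"
      by (auto simp: edge_def)
    have "roots y = roots x - {d}" using step_roots[OF P_substs] d by simp
    then have "card (roots y) = card (roots x) - 1" using d by (simp add: finite_roots)
    moreover have "card (roots x) > 0" using d finite_roots card_gt_0_iff by blast
    ultimately show ?thesis using ab card_roots[of x] by simp
  qed (use e in auto)
next
  fix a b assume ab: "(a, b) \<in> adjoin_top model_order" "a \<noteq> b"
  show "top_rank a < top_rank b"
  proof (cases a; cases b)
    fix x y assume xy: "a = Some x" "b = Some y"
    then have "roots y \<subset> roots x" using le_roots_psubset[OF P_substs P_substs, of x y] ab by simp
    then have "card (roots y) < card (roots x)" using psubset_card_mono[OF finite_roots] by blast
    then show ?thesis using xy card_roots[of x] by simp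
  qed (use ab in auto)
next
  fix a b assume ab: "(a, b) \<in> adjoin_top model_order" "a \<noteq> b"
  then obtain x where a: "a = Some x" and x: "x \<in> P" by (cases a; cases b) auto
  show "\<exists>u. top_edge a u \<and> (u, b) \<in> adjoin_top model_order \<and>
    (\<forall>w. top_edge a w \<and> (w, b) \<in> adjoin_top model_order \<and> w \<noteq> u \<longrightarrow>
       top_label (a, u) < top_label (a, w) \<and>
       (\<exists>v. top_edge w v \<and> (v, b) \<in> adjoin_top model_order \<and> top_label (w, v) \<le> top_label (a, w))) \<and>
    (\<forall>v. top_edge u v \<and> (v, b) \<in> adjoin_top model_order \<longrightarrow> top_label (a, u) < top_label (u, v))"
  proof (cases b)
    case (Some y)
    then have y: "y \<in> P" "le x y" "x \<noteq> y" using ab a by auto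
    from first_step_le[OF x y] obtain u where u: "edge x u" "le u y"
      "\<And>w. edge x w \<Longrightarrow> le w y \<Longrightarrow> w \<noteq> u \<Longrightarrow>
         edge_label x u < edge_label x w \<and> (\<exists>v. edge w v \<and> le v y \<and> edge_label w v \<le> edge_label x w)"
      "\<And>v. edge u v \<Longrightarrow> le v y \<Longrightarrow> edge_label x u < edge_label u v" by blast
    have uP: "u \<in> P" using u(1) by (simp add: edge_def)
    show ?thesis
    proof (rule exI[of _ "Some u"], intro conjI allI impI; (elim conjE)?)
      show "top_edge a (Some u)" "(Some u, b) \<in> adjoin_top model_order" using a Some u y uP by auto
      fix p assume p: "top_edge a p" "(p, b) \<in> adjoin_top model_order" "p \<noteq> Some u"
      then obtain w where w: "p = Some w" "edge x w" "le w y" "w \<noteq> u" using a Some by (cases p) auto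
      from u(3)[OF w(2,3,4)] obtain v where v: "edge_label x u < edge_label x w" "edge w v" "le v y" "edge_label w v \<le> edge_label x w"
        by blast
      show "top_label (a, Some u) < top_label (a, p)" using v a w by simp
      show "\<exists>v. top_edge p v \<and> (v, b) \<in> adjoin_top model_order \<and> top_label (p, v) \<le> top_label (a, p)"
        using v a w Some y by (intro exI[of _ "Some v"]) (auto simp: edge_def)
    next
      fix p assume p: "top_edge (Some u) p" "(p, b) \<in> adjoin_top model_order"
      then show "top_label (a, Some u) < top_label (Some u, p)" using u(4) a Some by (cases p) auto
    qed
  next
    case None
    show ?thesis
    proof (cases "roots x = {}")
      case True
      have "p = None" if "top_edge a p" for p using that True a by (cases p) (auto simp: edge_def)
      then show ?thesis using a None x True
        by (intro exI[of _ None]) auto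
    next
      case False
      from first_step_top[OF x False] obtain u where u: "edge x u"
        "\<And>w. edge x w \<Longrightarrow> w \<noteq> u \<Longrightarrow> edge_label x u < edge_label x w \<and>
          ((\<exists>v. edge w v \<and> edge_label w v \<le> edge_label x w) \<or> roots w = {} \<and> (1, 1) \<le> edge_label x w)"
        "\<And>v. edge u v \<Longrightarrow> edge_label x u < edge_label u v" "roots u = {} \<Longrightarrow> edge_label x u < (1, 1)" by blast
      have uP: "u \<in> P" using u(1) by (simp add: edge_def)
      show ?thesis
      proof (rule exI[of _ "Some u"], intro conjI allI impI; (elim conjE)?)
        show "top_edge a (Some u)" "(Some u, b) \<in> adjoin_top model_order" using a None u uP by auto
        fix p assume p: "top_edge a p" "(p, b) \<in> adjoin_top model_order" "p \<noteq> Some u"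
        then obtain w where w: "p = Some w" "edge x w" "w \<noteq> u" using a None False by (cases p) auto
        have wP: "w \<in> P" using w(2) by (simp add: edge_def)
        note uw = u(2)[OF w(2,3)]
        show "top_label (a, Some u) < top_label (a, p)" using uw a w by simp
        show "\<exists>v. top_edge p v \<and> (v, b) \<in> adjoin_top model_order \<and> top_label (p, v) \<le> top_label (a, p)"
        proof (cases "\<exists>v. edge w v \<and> edge_label w v \<le> edge_label x w")
          case True
          then obtain v where v: "edge w v" "edge_label w v \<le> edge_label x w" by blast
          then show ?thesis using a w None by (intro exI[of _ "Some v"]) (auto simp: edge_def)
        next
          case False
          then have "roots w = {}" "(1, 1) \<le> edge_label x w" using uw by auto
          then show ?thesis using a w None wP by (intro exI[of _ None]) auto
        qed
      next
        fix p assume p: "top_edge (Some u) p" "(p, b) \<in> adjoin_top model_order"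
        then show "top_label (a, Some u) < top_label (Some u, p)" using u(3,4) a by (cases p) auto
      qed
    qed
  qed
qed

lemma bounded_model: "bounded_poset (adjoin_top model_order)"
proof -
  \<comment> \<open>The bottom is the identity substitution: all blocks are singletons and nothing
    is coloured.\<close>
  define b where "b = (\<lambda>i\<in>{1..n}. Inl (i, \<one>) :: nat \<times> 'a + 's)"
  have bi: "b i = Inl (i, \<one>)" if "i \<in> {1..n}" for i using that by (simp add: b_def)
  have "b \<in> {1..n} \<rightarrow>\<^sub>E terms" by (auto simp: b_def)
  moreover have "m \<le> i \<and> b m = Inl (m, \<one>)" if "i \<in> {1..n}" "b i = Inl (m, g)" for i m g
    using that bi[OF that(1)] by auto
  ultimately have bs: "b \<in> substs" unfolding substs_def by blast
  have "colour_class b s = {}" for s using bi by (auto simp: colour_class_def)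
  then have bP: "b \<in> P" using bs by (simp add: P_def)
  have "le b y" if "y \<in> P" for y
    unfolding le_def using bi act_one substs_terms[OF P_substs[OF that]] by auto
  then show ?thesis
    unfolding bounded_poset_def using bP Partial_order_model by (auto simp: Field_adjoin_top_model)
qed

section \<open>The encoding of Dowling elements\<close>

lemma equiv_proj_rel: "equiv (B \<rightarrow>\<^sub>E carrier G) (proj_rel G B)"
proof (rule equivI)
  show "proj_rel G B \<subseteq> (B \<rightarrow>\<^sub>E carrier G) \<times> (B \<rightarrow>\<^sub>E carrier G)"
    by (auto simp: proj_rel_def)
  have "\<exists>g\<in>carrier G. \<forall>i\<in>B. b i = b i \<otimes> g" if "b \<in> B \<rightarrow>\<^sub>E carrier G" for b
    using PiE_mem[OF that] by (intro bexI[of _ \<one>]) auto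
  then show "refl_on (B \<rightarrow>\<^sub>E carrier G) (proj_rel G B)"
    unfolding refl_on_def proj_rel_def by blast
  show "sym (proj_rel G B)"
  proof (rule symI)
    fix a b assume "(a, b) \<in> proj_rel G B"
    then obtain g where ab: "a \<in> B \<rightarrow>\<^sub>E carrier G" "b \<in> B \<rightarrow>\<^sub>E carrier G"
      and g: "g \<in> carrier G" "\<And>i. i \<in> B \<Longrightarrow> b i = a i \<otimes> g" by (auto simp: proj_rel_def)
    have "a i = b i \<otimes> inv g" if "i \<in> B" for i
      using g PiE_mem[OF ab(1) that] that by (simp add: m_assoc)
    then show "(b, a) \<in> proj_rel G B" unfolding proj_rel_def using ab inv_closed[OF g(1)] by blast
  qed
  show "trans (proj_rel G B)"
  proof (rule transI)
    fix a b c assume "(a, b) \<in> proj_rel G B" "(b, c) \<in> proj_rel G B"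
    then obtain g h where abc: "a \<in> B \<rightarrow>\<^sub>E carrier G" "c \<in> B \<rightarrow>\<^sub>E carrier G"
      and g: "g \<in> carrier G" "\<And>i. i \<in> B \<Longrightarrow> b i = a i \<otimes> g"
      and h: "h \<in> carrier G" "\<And>i. i \<in> B \<Longrightarrow> c i = b i \<otimes> h" by (auto simp: proj_rel_def)
    have "c i = a i \<otimes> (g \<otimes> h)" if "i \<in> B" for i
      using g h PiE_mem[OF abc(1) that] that by (simp add: m_assoc)
    then show "(a, c) \<in> proj_rel G B" unfolding proj_rel_def using abc m_closed[OF g(1) h(1)] by blast
  qed
qed

lemma gblock_eqI:
  assumes "b \<in> B \<rightarrow>\<^sub>E carrier G" "c \<in> B \<rightarrow>\<^sub>E carrier G" "k \<in> carrier G" "\<And>i. i \<in> B \<Longrightarrow> c i = b i \<otimes> k"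
  shows "gblock G B b = gblock G B c"
proof -
  have "(b, c) \<in> proj_rel G B" unfolding proj_rel_def using assms by blast
  then show ?thesis using equiv_class_eq[OF equiv_proj_rel] by (simp add: gblock_def)
qed

lemma gblock_eqD:
  assumes "gblock G A a = gblock G B b" "b \<in> B \<rightarrow>\<^sub>E carrier G"
  shows "A = B" "\<exists>k\<in>carrier G. \<forall>i\<in>B. b i = a i \<otimes> k"
proof -
  show AB: "A = B" using assms by (simp add: gblock_def)
  have "proj_rel G B `` {a} = proj_rel G B `` {b}" using assms AB by (simp add: gblock_def)
  then have "(a, b) \<in> proj_rel G B" using eq_equiv_class[OF _ equiv_proj_rel assms(2)] by blast
  then show "\<exists>k\<in>carrier G. \<forall>i\<in>B. b i = a i \<otimes> k" by (simp add: proj_rel_def)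
qed

lemma fst_gblock [simp]: "fst (gblock G B b) = B"
  by (simp add: gblock_def)

definition blk :: "(nat \<Rightarrow> nat \<times> 'a + 's) \<Rightarrow> nat \<Rightarrow> nat set" where
  "blk x m = {i \<in> {1..n}. \<exists>g. x i = Inl (m, g)}"

definition val :: "(nat \<Rightarrow> nat \<times> 'a + 's) \<Rightarrow> nat \<Rightarrow> nat \<Rightarrow> 'a" where
  "val x m = (\<lambda>i\<in>blk x m. snd (projl (x i)))"

definition gb :: "(nat \<Rightarrow> nat \<times> 'a + 's) \<Rightarrow> nat \<Rightarrow> 'a gblock" where
  "gb x m = gblock G (blk x m) (val x m)"

definition zeros :: "(nat \<Rightarrow> nat \<times> 'a + 's) \<Rightarrow> nat set" where
  "zeros x = {i \<in> {1..n}. \<exists>s. x i = Inr s}"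

definition enc :: "(nat \<Rightarrow> nat \<times> 'a + 's) \<Rightarrow> ('a, 's) dowling_elt" where
  "enc x = (gb x ` roots x, \<lambda>i\<in>zeros x. projr (x i))"

lemma fst_gb [simp]: "fst (gb x m) = blk x m"
  by (simp add: gb_def)

lemma blkI: "i \<in> {1..n} \<Longrightarrow> x i = Inl (m, g) \<Longrightarrow> i \<in> blk x m \<and> val x m i = g"
  by (auto simp: blk_def val_def)

lemma blkD: "i \<in> blk x m \<Longrightarrow> i \<in> {1..n} \<and> x i = Inl (m, val x m i)"
  by (auto simp: blk_def val_def)

lemma val_ext: "i \<notin> blk x m \<Longrightarrow> val x m i = undefined"
  by (simp add: val_def)

lemma val_carrier: "x \<in> substs \<Longrightarrow> i \<in> blk x m \<Longrightarrow> val x m i \<in> carrier G"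
  using blkD[of i x m] substs_Inl(4)[of x i m "val x m i"] by blast

lemma val_PiE: "x \<in> substs \<Longrightarrow> val x m \<in> blk x m \<rightarrow>\<^sub>E carrier G"
  using val_carrier val_ext by (intro PiE_I) auto

lemma root_blk: "m \<in> roots x \<Longrightarrow> m \<in> blk x m \<and> val x m m = \<one>"
  using blkI[of m x m \<one>] rootsD[of m x] by simp

lemma blk_ge: "x \<in> substs \<Longrightarrow> i \<in> blk x m \<Longrightarrow> m \<le> i \<and> m \<in> roots x"
  using blkD[of i x m] substs_Inl(1,2)[of x i m "val x m i"] by blast

lemma blk_disjoint: "i \<in> blk x m \<Longrightarrow> i \<in> blk x m' \<Longrightarrow> m = m'"
  using blkD[of i x m] blkD[of i x m'] by simp

lemma blk_inj:
  assumes "m \<in> roots x" "m' \<in> roots x'" "blk x m = blk x' m'" "x \<in> substs" "x' \<in> substs"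
  shows "m = m'"
proof -
  have "m \<in> blk x' m'" "m' \<in> blk x m" using root_blk assms by blast+
  then show ?thesis using blk_ge assms(4,5) by (meson le_antisym order_antisym)
qed

lemma gb_inj: "x \<in> substs \<Longrightarrow> inj_on (gb x) (roots x)"
  using blk_inj by (metis fst_gb inj_onI)

lemma zeros_blk:
  assumes "x \<in> substs"
  shows "zeros x = {1..n} - (\<Union>m\<in>roots x. blk x m)"
proof
  show "zeros x \<subseteq> {1..n} - (\<Union>m\<in>roots x. blk x m)"
    by (auto simp: zeros_def blk_def)
  show "{1..n} - (\<Union>m\<in>roots x. blk x m) \<subseteq> zeros x"
  proof
    fix i assume i: "i \<in> {1..n} - (\<Union>m\<in>roots x. blk x m)"
    then have i': "i \<in> {1..n}" by simp
    show "i \<in> zeros x"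
      using substs_terms[OF assms i']
    proof (cases rule: terms_cases)
      case (1 m g)
      then show ?thesis using substs_Inl(1)[OF assms i' 1(1)] blkI[where x = x, OF i' 1(1)] i by auto
    next
      case (2 s)
      then show ?thesis using i' by (auto simp: zeros_def)
    qed
  qed
qed

lemma zero_block_enc: "x \<in> substs \<Longrightarrow> zero_block n (gb x ` roots x) = zeros x"
  by (simp add: zero_block_def zeros_blk image_image)

lemma enc_Dowling:
  assumes x: "x \<in> substs"
  shows "enc x \<in> Dowling n G S"
proof -
  define A where "A = (\<Union>m\<in>roots x. blk x m)"
  have An: "A \<subseteq> {1..n}" by (auto simp: A_def blk_def)
  have f: "fst ` gb x ` roots x = blk x ` roots x" by (simp add: image_image)
  have "partition_on A (blk x ` roots x)"
  proof (rule partition_onI)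
    show "\<Union> (blk x ` roots x) = A" by (simp add: A_def)
    show "disjnt p q" if pq: "p \<in> blk x ` roots x" "q \<in> blk x ` roots x" "p \<noteq> q" for p q
    proof -
      obtain m m' where "p = blk x m" "q = blk x m'" "m \<noteq> m'" using pq by blast
      then show ?thesis using blk_disjoint[of _ x m m'] by (auto simp: disjnt_def)
    qed
    show "{} \<notin> blk x ` roots x" using root_blk by blast
  qed
  moreover have "inj_on fst (gb x ` roots x)"
    using blk_inj[OF _ _ _ x x] by (auto simp: inj_on_def)
  moreover have "c \<in> (B \<rightarrow>\<^sub>E carrier G) // proj_rel G B" if "(B, c) \<in> gb x ` roots x" for B c
    using that quotientI[OF val_PiE[OF x]] by (auto simp: gb_def gblock_def)
  ultimately have "gb x ` roots x \<in> partial_G_partitions n G"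
    unfolding partial_G_partitions_def mem_Collect_eq f using An by blast
  moreover have "(\<lambda>i\<in>zeros x. projr (x i)) \<in> zeros x \<rightarrow>\<^sub>E S"
    using substs_Inr[OF x] by (auto simp: zeros_def)
  ultimately show ?thesis by (simp add: Dowling_def enc_def zero_block_enc[OF x])
qed

text \<open>Equal blocks have equal minima. Two representatives of one block differ by a right
  factor, and both are \<open>\<one>\<close> at the minimum, so this factor is
  \<open>\<one>\<close>.\<close>

lemma enc_inj: "inj_on enc substs"
proof (rule inj_onI)
  fix x y assume x: "x \<in> substs" and y: "y \<in> substs" and e: "enc x = enc y"
  have gbs: "gb x ` roots x = gb y ` roots y"
    and z: "(\<lambda>i\<in>zeros x. projr (x i)) = (\<lambda>i\<in>zeros y. projr (y i))"
    using e by (auto simp: enc_def)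
  have zz: "zeros x = zeros y" using zero_block_enc[OF x] zero_block_enc[OF y] gbs by simp
  show "x = y"
  proof
    fix i show "x i = y i"
    proof (cases "i \<in> {1..n}")
      case i: True
      show ?thesis
        using substs_terms[OF x i]
      proof (cases rule: terms_cases)
        case (1 m g)
        have m: "m \<in> roots x" using substs_Inl(1)[OF x i 1(1)] .
        then obtain m' where m': "m' \<in> roots y" "gb x m = gb y m'" using gbs by blast
        have b: "blk x m = blk y m'" using m'(2) fst_gb by metis
        have mm: "m' = m" using blk_inj[OF m m'(1) b x y] by simp
        obtain k where k: "k \<in> carrier G" "\<And>j. j \<in> blk y m \<Longrightarrow> val y m j = val x m j \<otimes> k"
          using gblock_eqD(2)[OF m'(2)[unfolded gb_def] val_PiE[OF y]] mm by auto
        have "k = \<one>" using k(2)[of m] root_blk[OF m] root_blk[OF m'(1)] mm k(1) by simp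
        moreover have i': "i \<in> blk y m" "val x m i = g" using blkI[where x = x, OF i 1(1)] b mm by auto
        ultimately have "val y m i = g" using k(2)[of i] 1 by simp
        then show ?thesis using blkD[OF i'(1)] 1 by simp
      next
        case (2 s)
        then have "i \<in> zeros x" using i by (auto simp: zeros_def)
        moreover from this zz obtain s' where "y i = Inr s'" by (auto simp: zeros_def)
        ultimately show ?thesis using fun_cong[OF z, of i] zz 2 by simp
      qed
    next
      case False
      then show ?thesis using substs_ext[OF x] substs_ext[OF y] by simp
    qed
  qed
qed

lemma enc_surj:
  assumes "p \<in> Dowling n G S"
  shows "\<exists>x\<in>substs. enc x = p"
proof -
  obtain \<beta> z where p: "p = (\<beta>, z)" by (cases p)
  have \<beta>: "\<beta> \<in> partial_G_partitions n G" and z: "z \<in> zero_block n \<beta> \<rightarrow>\<^sub>E S"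
    using assms p by (auto simp: Dowling_def)
  obtain A where A: "A \<subseteq> {1..n}" "partition_on A (fst ` \<beta>)" and inj: "inj_on fst \<beta>"
    and cl': "\<forall>(B, c)\<in>\<beta>. c \<in> (B \<rightarrow>\<^sub>E carrier G) // proj_rel G B"
    using \<beta> unfolding partial_G_partitions_def by blast
  have cl: "snd q \<in> (fst q \<rightarrow>\<^sub>E carrier G) // proj_rel G (fst q)" if "q \<in> \<beta>" for q
    using cl' that by (cases q) auto
  have "\<forall>q\<in>\<beta>. \<exists>b. b \<in> fst q \<rightarrow>\<^sub>E carrier G \<and> q = gblock G (fst q) b"
  proof
    fix q assume "q \<in> \<beta>"
    from cl[OF this] obtain b where "b \<in> fst q \<rightarrow>\<^sub>E carrier G" "snd q = proj_rel G (fst q) `` {b}"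
      by (rule quotientE)
    then show "\<exists>b. b \<in> fst q \<rightarrow>\<^sub>E carrier G \<and> q = gblock G (fst q) b"
      by (intro exI[of _ b]) (simp add: gblock_def prod_eq_iff)
  qed
  from bchoice[OF this] obtain rp where
    rp: "\<And>q. q \<in> \<beta> \<Longrightarrow> rp q \<in> fst q \<rightarrow>\<^sub>E carrier G" "\<And>q. q \<in> \<beta> \<Longrightarrow> q = gblock G (fst q) (rp q)" by blast
  have UA: "\<Union> (fst ` \<beta>) = A" using partition_onD1[OF A(2)] by simp
  have uniq: "q = q'" if "q \<in> \<beta>" "q' \<in> \<beta>" "i \<in> fst q" "i \<in> fst q'" for q q' i
  proof -
    have "fst q = fst q'"
      using partition_onD2[OF A(2)] that by (auto simp: disjoint_def)
    then show ?thesis using inj_onD[OF inj] that by blast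
  qed
  have "\<forall>i\<in>A. \<exists>q. q \<in> \<beta> \<and> i \<in> fst q" using UA by auto
  from bchoice[OF this] obtain bl where bl: "\<And>i. i \<in> A \<Longrightarrow> bl i \<in> \<beta>" "\<And>i. i \<in> A \<Longrightarrow> i \<in> fst (bl i)"
    by blast
  have subA: "i \<in> A" if "q \<in> \<beta>" "i \<in> fst q" for q i using UA that by blast
  have bl_eq: "bl i = q" if "q \<in> \<beta>" "i \<in> fst q" for q i
    using uniq[OF bl(1) that(1) bl(2) that(2)] subA[OF that] by blast
  define mn where "mn q = Min (fst q)" for q :: "'a gblock"
  have mn: "mn q \<in> fst q" "\<And>i. i \<in> fst q \<Longrightarrow> mn q \<le> i" if "q \<in> \<beta>" for q
  proof -
    have "finite (fst q)" using subA[OF that] A(1) by (meson finite_atLeastAtMost finite_subset subsetI)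
    moreover have "fst q \<noteq> {}" using partition_onD3[OF A(2)] that by auto
    ultimately show "mn q \<in> fst q" "\<And>i. i \<in> fst q \<Longrightarrow> mn q \<le> i" by (auto simp: mn_def)
  qed
  \<comment> \<open>Dividing by the value at the minimum normalizes the representative; a right
    factor in \<open>rp\<close> cancels, so the choice made by \<open>rp\<close> does not
    matter.\<close>
  define r where "r i = rp (bl i) i \<otimes> inv (rp (bl i) (mn (bl i)))" for i
  define x where "x = (\<lambda>i\<in>{1..n}. if i \<in> A then Inl (mn (bl i), r i) else Inr (z i))"
  have zb: "zero_block n \<beta> = {1..n} - A" by (simp add: zero_block_def UA)
  have rpc: "rp (bl i) j \<in> carrier G" if "i \<in> A" "j \<in> fst (bl i)" for i j
    using PiE_mem[OF rp(1)[OF bl(1)[OF that(1)]] that(2)] .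
  have rc: "r i \<in> carrier G" if "i \<in> A" for i
    unfolding r_def using rpc[OF that bl(2)[OF that]] rpc[OF that mn(1)[OF bl(1)[OF that]]] by simp
  have xA: "x i = Inl (mn (bl i), r i)" if "i \<in> A" for i using that A(1) by (auto simp: x_def)
  have xZ: "x i = Inr (z i)" if "i \<in> {1..n}" "i \<notin> A" for i using that by (simp add: x_def)
  have mnA: "mn q \<in> A" "bl (mn q) = q" "x (mn q) = Inl (mn q, \<one>)" if "q \<in> \<beta>" for q
  proof -
    show a: "mn q \<in> A" "bl (mn q) = q" using subA[OF that mn(1)[OF that]] bl_eq[OF that mn(1)[OF that]] by auto
    have "r (mn q) = \<one>" unfolding r_def a(2) using rpc[OF a(1)] mn(1)[OF that] a(2) by simp
    then show "x (mn q) = Inl (mn q, \<one>)" using xA[OF a(1)] a(2) by simp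
  qed
  have xs: "x \<in> substs"
  proof -
    have "x i \<in> terms" if "i \<in> {1..n}" for i
    proof (cases "i \<in> A")
      case True
      then have "mn (bl i) \<in> {1..n}" using mnA(1)[OF bl(1)] A(1) by blast
      then show ?thesis using xA[OF True] rc[OF True] by simp
    next
      case False
      then show ?thesis using xZ[OF that] PiE_mem[OF z] zb that by auto
    qed
    moreover have "x i = undefined" if "i \<notin> {1..n}" for i using that by (auto simp: x_def)
    ultimately have "x \<in> {1..n} \<rightarrow>\<^sub>E terms" by (intro PiE_I) auto
    moreover have "m \<le> i \<and> x m = Inl (m, \<one>)" if "i \<in> {1..n}" "x i = Inl (m, g)" for i m g
    proof -
      have iA: "i \<in> A" using that xZ by force
      then have "m = mn (bl i)" using xA that by simp
      then show ?thesis using mnA(3)[OF bl(1)[OF iA]] mn(2)[OF bl(1)[OF iA] bl(2)[OF iA]] by simp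
    qed
    ultimately show ?thesis unfolding substs_def by blast
  qed
  have roots: "roots x = mn ` \<beta>"
  proof
    show "mn ` \<beta> \<subseteq> roots x" using mnA(1,3) A(1) unfolding roots_def by blast
    show "roots x \<subseteq> mn ` \<beta>"
    proof
      fix d assume d: "d \<in> roots x"
      have dA: "d \<in> A" using xZ[OF rootsD(1)[OF d]] rootsD(2)[OF d] by auto
      then have "d = mn (bl d)" using xA[OF dA] rootsD(2)[OF d] by simp
      then show "d \<in> mn ` \<beta>" using bl(1)[OF dA] by blast
    qed
  qed
  have gbq: "gb x (mn q) = q" if q: "q \<in> \<beta>" for q
  proof -
    have b: "blk x (mn q) = fst q"
    proof
      show "fst q \<subseteq> blk x (mn q)"
      proof
        fix i assume i: "i \<in> fst q"
        then have "i \<in> {1..n}" using subA[OF q i] A(1) by blast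
        then show "i \<in> blk x (mn q)"
          using xA[OF subA[OF q i]] bl_eq[OF q i] by (simp add: blk_def)
      qed
      show "blk x (mn q) \<subseteq> fst q"
      proof
        fix i assume ib: "i \<in> blk x (mn q)"
        have i: "i \<in> {1..n}" "x i = Inl (mn q, val x (mn q) i)" using blkD[OF ib] by auto
        have iA: "i \<in> A" using xZ[OF i(1)] i(2) by force
        have "mn (bl i) = mn q" using xA[OF iA] i(2) by simp
        then have "bl i = q" using mnA(2) bl(1)[OF iA] q by metis
        then show "i \<in> fst q" using bl(2)[OF iA] by simp
      qed
    qed
    have "gblock G (fst q) (rp q) = gblock G (fst q) (val x (mn q))"
    proof (rule gblock_eqI[OF rp(1)[OF q]])
      show "val x (mn q) \<in> fst q \<rightarrow>\<^sub>E carrier G" using val_PiE[OF xs, of "mn q"] b by simp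
      show "inv (rp q (mn q)) \<in> carrier G" using PiE_mem[OF rp(1)[OF q] mn(1)[OF q]] by simp
      fix i assume i: "i \<in> fst q"
      have "x i = Inl (mn q, r i)" using xA[OF subA[OF q i]] bl_eq[OF q i] by simp
      moreover have "i \<in> {1..n}" using subA[OF q i] A(1) by blast
      ultimately have "val x (mn q) i = r i" using blkI[of i x "mn q" "r i"] by simp
      then show "val x (mn q) i = rp q i \<otimes> inv (rp q (mn q))" using bl_eq[OF q i] by (simp add: r_def)
    qed
    then show ?thesis unfolding gb_def b using rp(2)[OF q] by simp
  qed
  have "gb x ` roots x = \<beta>" using gbq by (force simp: roots image_image)
  moreover have "(\<lambda>i\<in>zeros x. projr (x i)) = z"
  proof
    have zx: "zeros x = {1..n} - A" using zero_block_enc[OF xs] calculation zb by simp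
    fix i show "(\<lambda>i\<in>zeros x. projr (x i)) i = z i"
      using xZ[of i] PiE_arb[OF z, of i] by (cases "i \<in> zeros x") (auto simp: zx zb)
  qed
  ultimately show ?thesis using xs p by (intro bexI[of _ x]) (auto simp: enc_def)
qed

section \<open>Steps of substitutions compared with the generating relations of the Dowling
  poset\<close>

lemma gb_step_other:
  assumes x: "x \<in> substs" and d: "d \<in> roots x" and t: "t \<in> targets x d"
    and m: "m \<noteq> d" "\<And>g. t \<noteq> Inl (m, g)"
  shows "gb (step x d t) m = gb x m"
proof -
  have e: "step x d t i = Inl (m, g) \<longleftrightarrow> x i = Inl (m, g)" if i: "i \<in> {1..n}" for i g
    using substs_terms[OF x i]
  proof (cases rule: terms_cases)
    case (1 m' h)
    show ?thesis
    proof (cases "m' = d")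
      case True
      have "act h t \<noteq> Inl (m, g)" using m(2) by (metis act_Inl_cases)
      then show ?thesis using step_at(3)[where x = x, OF i] 1(1) True m(1) by auto
    next
      case False
      then show ?thesis using step_at(2)[where x = x, OF i 1(1) False] 1(1) by simp
    qed
  next
    case (2 s)
    then show ?thesis using step_at(1)[where x = x, OF i 2(1)] by simp
  qed
  have b: "blk (step x d t) m = blk x m" unfolding blk_def using e by blast
  have "val (step x d t) m i = val x m i" for i
  proof (cases "i \<in> blk x m")
    case True
    then show ?thesis using blkD[OF True] e[of i] blkI[of i "step x d t" m] by simp
  next
    case False
    then show ?thesis using b val_ext by simp
  qed
  then show ?thesis unfolding gb_def b by (metis ext)
qed

text \<open>Here \<open>c\<close> may be any representative of the merged block, and
  \<open>k\<close> is its value at \<open>e\<close>. This freedom serves the converse direction,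
  where a generating relation comes with unnormalized functions.\<close>

lemma enc_step_merge:
  assumes x: "x \<in> substs" and d: "d \<in> roots x" and e: "e \<in> roots x" "e < d" and g: "g \<in> carrier G"
    and c: "c \<in> blk x e \<union> blk x d \<rightarrow>\<^sub>E carrier G" and k: "k \<in> carrier G"
    and ce: "\<And>i. i \<in> blk x e \<Longrightarrow> c i = val x e i \<otimes> k"
    and cd: "\<And>i. i \<in> blk x d \<Longrightarrow> c i = val x d i \<otimes> (g \<otimes> k)"
  shows "enc (step x d (Inl (e, g))) =
    (gb x ` (roots x - {d, e}) \<union> {gblock G (blk x e \<union> blk x d) c}, snd (enc x))"
proof -
  define y where "y = step x d (Inl (e, g))"
  have t: "Inl (e, g) \<in> targets x d" using e g by (auto simp: targets_def)
  have ys: "y \<in> substs" using step_substs[OF x d t] by (simp add: y_def)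
  have ry: "roots y = roots x - {d}" using step_roots[OF x d t] by (simp add: y_def)
  have ye: "y i = Inl (e, val x e i)" if "i \<in> blk x e" for i
    using step_at(2)[where x = x] blkD[OF that] e(2) by (simp add: y_def)
  have yd: "y i = Inl (e, val x d i \<otimes> g)" if "i \<in> blk x d" for i
    using step_at(3)[where x = x and t = "Inl (e, g)"] blkD[OF that] by (simp add: y_def)
  have b: "blk y e = blk x e \<union> blk x d"
  proof
    show "blk x e \<union> blk x d \<subseteq> blk y e"
    proof
      fix i assume "i \<in> blk x e \<union> blk x d"
      then have "i \<in> {1..n} \<and> (\<exists>g. y i = Inl (e, g))"
        using ye[of i] yd[of i] blkD[of i x e] blkD[of i x d] by blast
      then show "i \<in> blk y e" by (simp add: blk_def)
    qed
    show "blk y e \<subseteq> blk x e \<union> blk x d"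
    proof
      fix i assume ib: "i \<in> blk y e"
      have i: "i \<in> {1..n}" "y i = Inl (e, val y e i)" using blkD[OF ib] by auto
      show "i \<in> blk x e \<union> blk x d"
        using substs_terms[OF x i(1)]
      proof (cases rule: terms_cases)
        case (1 m h)
        then have "m = d \<or> m = e" using step_at(2)[where x = x, OF i(1) 1(1)] i(2) y_def by force
        then show ?thesis using blkI[where x = x, OF i(1) 1(1)] by auto
      next
        case (2 s)
        then show ?thesis using step_at(1)[where x = x, OF i(1) 2(1)] i(2) y_def by simp
      qed
    qed
  qed
  have "gblock G (blk y e) (val y e) = gblock G (blk y e) c"
  proof (rule gblock_eqI[OF val_PiE[OF ys] _ k])
    show "c \<in> blk y e \<rightarrow>\<^sub>E carrier G" using c b by simp
    fix i assume "i \<in> blk y e"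
    then consider "i \<in> blk x e" | "i \<in> blk x d" using b by auto
    then show "c i = val y e i \<otimes> k"
    proof cases
      case 1
      then have "val y e i = val x e i" using blkI[of i y e "val x e i"] ye[OF 1] blkD[OF 1] by simp
      then show ?thesis using ce[OF 1] by simp
    next
      case 2
      then have "val y e i = val x d i \<otimes> g" using blkI[of i y e "val x d i \<otimes> g"] yd[OF 2] blkD[OF 2] by simp
      then show ?thesis using cd[OF 2] val_carrier[OF x 2] g k by (simp add: m_assoc)
    qed
  qed
  then have gbe: "gb y e = gblock G (blk x e \<union> blk x d) c" by (simp add: gb_def b)
  have gbo: "gb y m = gb x m" if "m \<in> roots x - {d, e}" for m
    using gb_step_other[OF x d t, of m] that by (simp add: y_def)
  have "roots y = insert e (roots x - {d, e})" using ry e by auto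
  then have g1: "gb y ` roots y = gb x ` (roots x - {d, e}) \<union> {gblock G (blk x e \<union> blk x d) c}"
    using gbe gbo by auto
  have yz: "y i = Inr s \<longleftrightarrow> x i = Inr s" if "i \<in> {1..n}" for i s
    using that by (auto simp: y_def step_def split: sum.splits)
  then have zz: "zeros y = zeros x" by (auto simp: zeros_def)
  have "(\<lambda>i\<in>zeros y. projr (y i)) = (\<lambda>i\<in>zeros x. projr (x i))"
    unfolding zz
  proof (rule restrict_ext)
    fix i assume "i \<in> zeros x"
    then obtain s where "i \<in> {1..n}" "x i = Inr s" by (auto simp: zeros_def)
    then show "projr (y i) = projr (x i)" using yz[of i s] by simp
  qed
  then show ?thesis using g1 by (simp add: enc_def y_def)
qed

lemma enc_step_colour:
  assumes x: "x \<in> substs" and d: "d \<in> roots x" and s: "s \<in> S"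
    and z: "z \<in> extensional (zeros x \<union> blk x d)"
    and z1: "\<And>i. i \<in> zeros x \<Longrightarrow> z i = snd (enc x) i"
    and z2: "\<And>i. i \<in> blk x d \<Longrightarrow> z i = \<phi> (val x d i) s"
  shows "enc (step x d (Inr s)) = (gb x ` (roots x - {d}), z)"
proof -
  define y where "y = step x d (Inr s)"
  have t: "Inr s \<in> targets x d" using s by (auto simp: targets_def)
  have ys: "y \<in> substs" using step_substs[OF x d t] by (simp add: y_def)
  have ry: "roots y = roots x - {d}" using step_roots[OF x d t] by (simp add: y_def)
  have gbo: "gb y m = gb x m" if "m \<in> roots x - {d}" for m
    using gb_step_other[OF x d t, of m] that by (simp add: y_def)
  have g1: "gb y ` roots y = gb x ` (roots x - {d})" unfolding ry using gbo by simp
  have yd: "y i = Inr (\<phi> (val x d i) s)" if "i \<in> blk x d" for i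
    using step_at(3)[where x = x and t = "Inr s"] blkD[OF that] by (simp add: y_def)
  have yz: "y i = x i" if "i \<in> zeros x" for i
    using step_at(1)[where x = x] that by (auto simp: y_def zeros_def)
  have zz: "zeros y = zeros x \<union> blk x d"
  proof
    show "zeros x \<union> blk x d \<subseteq> zeros y"
    proof
      fix i assume "i \<in> zeros x \<union> blk x d"
      then have "i \<in> {1..n} \<and> (\<exists>s. y i = Inr s)"
        using yz[of i] yd[of i] blkD[of i x d] by (auto simp: zeros_def)
      then show "i \<in> zeros y" by (simp add: zeros_def)
    qed
    show "zeros y \<subseteq> zeros x \<union> blk x d"
    proof
      fix i assume "i \<in> zeros y"
      then obtain s' where i: "i \<in> {1..n}" "y i = Inr s'" by (auto simp: zeros_def)
      show "i \<in> zeros x \<union> blk x d"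
        using substs_terms[OF x i(1)]
      proof (cases rule: terms_cases)
        case (1 m h)
        then have "m = d" using step_at(2)[where x = x, OF i(1) 1(1)] i(2) y_def by force
        then show ?thesis using blkI[where x = x, OF i(1) 1(1)] by auto
      next
        case (2 s)
        then show ?thesis using i by (auto simp: zeros_def)
      qed
    qed
  qed
  have "(\<lambda>i\<in>zeros y. projr (y i)) = z"
  proof
    fix i show "(\<lambda>i\<in>zeros y. projr (y i)) i = z i"
    proof (cases "i \<in> zeros y")
      case True
      then consider "i \<in> zeros x" | "i \<in> blk x d" using zz by auto
      then show ?thesis
      proof cases
        case 1
        then show ?thesis using True yz[OF 1] z1[OF 1] by (simp add: enc_def)
      next
        case 2
        then show ?thesis using True yd[OF 2] z2[OF 2] by simp
      qed
    next
      case False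
      then show ?thesis using z zz by (simp add: extensional_def)
    qed
  qed
  then show ?thesis using g1 by (simp add: enc_def y_def)
qed

lemma Dowling_step_of_step:
  assumes x: "x \<in> substs" and d: "d \<in> roots x" and t: "t \<in> targets x d"
  shows "Dowling_step n G S \<phi> (enc x) (enc (step x d t))"
  using t
proof (cases rule: targets_cases)
  case (1 e g)
  define c where "c = (\<lambda>i\<in>blk x e \<union> blk x d. if i \<in> blk x e then val x e i else val x d i \<otimes> g)"
  have ed: "e \<noteq> d" using 1 by simp
  have disj: "i \<notin> blk x e" if "i \<in> blk x d" for i using blk_disjoint that ed by blast
  have c: "c \<in> blk x e \<union> blk x d \<rightarrow>\<^sub>E carrier G" using val_carrier[OF x] 1(4) by (auto simp: c_def)
  have ce: "c i = val x e i" if "i \<in> blk x e" for i using that by (simp add: c_def)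
  have cd: "c i = val x d i \<otimes> g" if "i \<in> blk x d" for i using that disj by (simp add: c_def)
  have st: "enc (step x d t) = (gb x ` (roots x - {d, e}) \<union> {gblock G (blk x e \<union> blk x d) c}, snd (enc x))"
    unfolding 1(1)
  proof (rule enc_step_merge[OF x d 1(2,3,4) c one_closed])
    show "c i = val x e i \<otimes> \<one>" if "i \<in> blk x e" for i using ce[OF that] val_carrier[OF x that] by simp
    show "c i = val x d i \<otimes> (g \<otimes> \<one>)" if "i \<in> blk x d" for i using cd[OF that] 1(4) by simp
  qed
  have rr: "roots x = (roots x - {d, e}) \<union> {e, d}" using d 1 by auto
  have src: "enc x = (gb x ` (roots x - {d, e}) \<union> {gblock G (blk x e) (val x e), gblock G (blk x d) (val x d)}, snd (enc x))"
  proof -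
    have "gb x ` roots x = gb x ` (roots x - {d, e}) \<union> {gb x e, gb x d}" using rr by blast
    then show ?thesis by (simp add: enc_def gb_def)
  qed
  have ne: "gb x e \<notin> gb x ` (roots x - {d, e})" "gb x d \<notin> gb x ` (roots x - {d, e})" "gb x e \<noteq> gb x d"
    using inj_onD[OF gb_inj[OF x]] d 1(2) ed by blast+
  show ?thesis
    unfolding st
    by (subst src, rule Dowling_step.merge[where g = g])
      (use enc_Dowling[OF x] src ne val_PiE[OF x] c 1(4) ce cd in \<open>auto simp: gb_def\<close>)
next
  case (2 s)
  define z where "z = (\<lambda>i\<in>zeros x \<union> blk x d. if i \<in> zeros x then snd (enc x) i else \<phi> (val x d i) s)"
  have disj: "i \<notin> zeros x" if "i \<in> blk x d" for i using zeros_blk[OF x] that d by auto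
  have z1: "z i = snd (enc x) i" if "i \<in> zeros x" for i using that by (simp add: z_def)
  have z2: "z i = \<phi> (val x d i) s" if "i \<in> blk x d" for i using that disj by (simp add: z_def)
  have st: "enc (step x d t) = (gb x ` (roots x - {d}), z)"
    unfolding 2(1) by (rule enc_step_colour[OF x d 2(2) _ z1 z2]) (unfold z_def, rule restrict_extensional)
  have gbs: "gb x ` (roots x - {d}) \<union> {gblock G (blk x d) (val x d)} = gb x ` roots x"
    using d by (auto simp: gb_def)
  have src: "enc x = (gb x ` (roots x - {d}) \<union> {gblock G (blk x d) (val x d)}, snd (enc x))"
    unfolding gbs by (simp add: enc_def)
  have ne: "gb x d \<notin> gb x ` (roots x - {d})" using inj_onD[OF gb_inj[OF x]] d by blast
  have ex: "snd (enc x) i \<in> S" if "i \<in> zeros x" for i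
    using that substs_Inr[OF x] by (auto simp: enc_def zeros_def)
  have zb: "zero_block n (gb x ` (roots x - {d}) \<union> {gblock G (blk x d) (val x d)}) = zeros x"
    unfolding gbs by (rule zero_block_enc[OF x])
  show ?thesis
    unfolding st
  proof (subst src, rule Dowling_step.color[where s = s])
    show "(gb x ` (roots x - {d}) \<union> {gblock G (blk x d) (val x d)}, snd (enc x)) \<in> Dowling n G S"
      using enc_Dowling[OF x] src by simp
    show "gblock G (blk x d) (val x d) \<notin> gb x ` (roots x - {d})" using ne by (simp add: gb_def)
    show "val x d \<in> blk x d \<rightarrow>\<^sub>E carrier G" by (rule val_PiE[OF x])
    show "z \<in> zero_block n (gb x ` (roots x - {d}) \<union> {gblock G (blk x d) (val x d)}) \<union> blk x d \<rightarrow>\<^sub>E S"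
      unfolding zb using ex \<phi>_closed[OF val_carrier[OF x] 2(2)] by (auto simp: z_def)
  qed (use z1 z2 2(2) zb in auto)
qed

text \<open>A generating merge is indifferent to minima: its two blocks come in either order and
  with arbitrary representatives. After normalization the block with the larger minimum counts as
  absorbed, and the factor is the quotient of the two right factors.\<close>

lemma step_of_Dowling_step:
  assumes x: "x \<in> substs" and st: "Dowling_step n G S \<phi> (enc x) p"
  shows "\<exists>d\<in>roots x. \<exists>t\<in>targets x d. p = enc (step x d t)"
  using st
proof cases
  case (merge \<beta> A a B b z c g)
  have gbs: "gb x ` roots x = \<beta> \<union> {gblock G A a, gblock G B b}" and z: "z = snd (enc x)"
    using merge(1) by (auto simp: enc_def)
  obtain m1 where m1: "m1 \<in> roots x" "gb x m1 = gblock G A a" using gbs by (metis UnCI imageE insertI1)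
  have "gblock G B b \<in> gb x ` roots x" unfolding gbs by simp
  then obtain m2 where m2: "m2 \<in> roots x" "gb x m2 = gblock G B b" by (metis imageE)
  have m12: "m1 \<noteq> m2" using m1 m2 merge(6) by auto
  have \<beta>: "\<beta> = gb x ` (roots x - {m1, m2})"
  proof -
    have "\<beta> = gb x ` roots x - {gb x m1, gb x m2}" using gbs m1 m2 merge(4,5) by auto
    also have "\<dots> = gb x ` (roots x - {m1, m2})"
      using inj_on_image_set_diff[OF gb_inj[OF x], of "roots x" "{m1, m2}"] m1 m2 by simp
    finally show ?thesis .
  qed
  obtain k1 where A: "blk x m1 = A" and k1: "k1 \<in> carrier G" "\<And>i. i \<in> A \<Longrightarrow> a i = val x m1 i \<otimes> k1"
    using gblock_eqD[OF m1(2)[unfolded gb_def] merge(7)] by auto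
  obtain k2 where B: "blk x m2 = B" and k2: "k2 \<in> carrier G" "\<And>i. i \<in> B \<Longrightarrow> b i = val x m2 i \<otimes> k2"
    using gblock_eqD[OF m2(2)[unfolded gb_def] merge(8)] by auto
  \<comment> \<open>The function \<open>c\<close> is the normalized one times \<open>k1\<close> on
    \<open>A\<close> and times \<open>k3\<close> on \<open>B\<close>, so
    \<open>k3 \<otimes> inv k1\<close> or its inverse is the factor between the two roots.\<close>
  define k3 where "k3 = k2 \<otimes> g"
  have k3: "k3 \<in> carrier G" using k2 merge(10) by (simp add: k3_def)
  have c1: "c i = val x m1 i \<otimes> k1" if "i \<in> blk x m1" for i using merge(11) k1 A that by simp
  have c2: "c i = val x m2 i \<otimes> k3" if "i \<in> blk x m2" for i
    using merge(10,12) k2 B that val_carrier[OF x that] by (simp add: k3_def m_assoc)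
  consider "m1 < m2" | "m2 < m1" using m12 by linarith
  then show ?thesis
  proof cases
    case 1
    have g: "k3 \<otimes> inv k1 \<in> carrier G" using k1 k3 by simp
    have "enc (step x m2 (Inl (m1, k3 \<otimes> inv k1))) =
      (gb x ` (roots x - {m2, m1}) \<union> {gblock G (blk x m1 \<union> blk x m2) c}, snd (enc x))"
    proof (rule enc_step_merge[OF x m2(1) m1(1) 1 g _ k1(1) c1])
      show "c \<in> blk x m1 \<union> blk x m2 \<rightarrow>\<^sub>E carrier G" using merge(9) A B by simp
      show "c i = val x m2 i \<otimes> (k3 \<otimes> inv k1 \<otimes> k1)" if "i \<in> blk x m2" for i
        using c2[OF that] k1(1) k3 by (simp add: m_assoc)
    qed
    also have "\<dots> = p" using merge(2) \<beta> A B z by (simp add: insert_commute)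
    finally show ?thesis using m2(1) m1 1 g
      by (intro bexI[of _ m2] bexI[of _ "Inl (m1, k3 \<otimes> inv k1)"]) (auto simp: targets_def)
  next
    case 2
    have g: "k1 \<otimes> inv k3 \<in> carrier G" using k1 k3 by simp
    have "enc (step x m1 (Inl (m2, k1 \<otimes> inv k3))) =
      (gb x ` (roots x - {m1, m2}) \<union> {gblock G (blk x m2 \<union> blk x m1) c}, snd (enc x))"
    proof (rule enc_step_merge[OF x m1(1) m2(1) 2 g _ k3 c2])
      show "c \<in> blk x m2 \<union> blk x m1 \<rightarrow>\<^sub>E carrier G" using merge(9) A B by (simp add: Un_commute)
      show "c i = val x m1 i \<otimes> (k1 \<otimes> inv k3 \<otimes> k3)" if "i \<in> blk x m1" for i
        using c1[OF that] k1(1) k3 by (simp add: m_assoc)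
    qed
    also have "\<dots> = p" using merge(2) \<beta> A B z by (simp add: Un_commute)
    finally show ?thesis using m1(1) m2 2 g
      by (intro bexI[of _ m1] bexI[of _ "Inl (m2, k1 \<otimes> inv k3)"]) (auto simp: targets_def)
  qed
next
  case (color \<beta> B b z z' s)
  have gbs: "gb x ` roots x = \<beta> \<union> {gblock G B b}" and z: "z = snd (enc x)"
    using color(1) by (auto simp: enc_def)
  obtain d where d: "d \<in> roots x" "gb x d = gblock G B b" using gbs by (metis UnCI imageE insertI1)
  have \<beta>: "\<beta> = gb x ` (roots x - {d})"
  proof -
    have "\<beta> = gb x ` roots x - {gb x d}" using gbs d color(4) by auto
    also have "\<dots> = gb x ` (roots x - {d})"
      using inj_on_image_set_diff[OF gb_inj[OF x], of "roots x" "{d}"] d by simp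
    finally show ?thesis .
  qed
  obtain k where B: "blk x d = B" and k: "k \<in> carrier G" "\<And>i. i \<in> B \<Longrightarrow> b i = val x d i \<otimes> k"
    using gblock_eqD[OF d(2)[unfolded gb_def] color(5)] by auto
  have zb: "zero_block n (\<beta> \<union> {gblock G B b}) = zeros x"
    using zero_block_enc[OF x] gbs by simp
  \<comment> \<open>The right factor \<open>k\<close> of \<open>b\<close> passes into the colour:
    acting with \<open>b i\<close> on \<open>s\<close> is acting with the normalized value on
    \<open>\<phi> k s\<close>, which is the colour of the root.\<close>
  have s: "\<phi> k s \<in> S" using \<phi>_closed[OF k(1) color(8)] .
  have "enc (step x d (Inr (\<phi> k s))) = (gb x ` (roots x - {d}), z')"
  proof (rule enc_step_colour[OF x d(1) s])
    show "z' \<in> extensional (zeros x \<union> blk x d)" using color(6) zb B by (simp add: PiE_def)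
    show "z' i = snd (enc x) i" if "i \<in> zeros x" for i using color(7) zb z that by simp
    show "z' i = \<phi> (val x d i) (\<phi> k s)" if "i \<in> blk x d" for i
      using color(9) k B that val_carrier[OF x that] composition_rule[OF color(8)] by simp
  qed
  then show ?thesis using color(2) \<beta> d(1) s
    by (intro bexI[of _ d] bexI[of _ "Inr (\<phi> k s)"]) (auto simp: targets_def)
qed

text \<open>Generating steps are steps of substitutions and so go up in \<open>le\<close>.
  Conversely, while some root of \<open>x\<close> is lost in \<open>y\<close>, its canonical target
  gives a generating step that stays below \<open>y\<close> and removes one root. The elements
  passed on the way may lie outside \<open>P\<close>, in accordance with the induced order on the
  subposet.\<close>

lemma Dowling_order_enc:
  assumes x: "x \<in> substs" and y: "y \<in> substs"
  shows "(enc x, enc y) \<in> Dowling_order n G S \<phi> \<longleftrightarrow> le x y"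
proof
  assume "(enc x, enc y) \<in> Dowling_order n G S \<phi>"
  then have "(Dowling_step n G S \<phi>)\<^sup>*\<^sup>* (enc x) (enc y)" by (simp add: Dowling_order_def)
  then have "\<exists>w\<in>substs. enc y = enc w \<and> le x w"
  proof (induction rule: rtranclp_induct)
    case base
    then show ?case using x le_refl by blast
  next
    case (step p q)
    then obtain w where w: "w \<in> substs" "p = enc w" "le x w" by blast
    obtain d t where d: "d \<in> roots w" "t \<in> targets w d" "q = enc (step w d t)"
      using step_of_Dowling_step[OF w(1)] step(2) w(2) by blast
    then show ?case
      using step_substs[OF w(1) d(1,2)] le_trans[OF x w(1) _ w(3) le_step[OF w(1) d(1,2)]] by blast
  qed
  then show "le x y" using inj_onD[OF enc_inj _ y] by blast
next
  assume "le x y"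
  then have "(Dowling_step n G S \<phi>)\<^sup>*\<^sup>* (enc x) (enc y)"
    using x
  proof (induction "card (roots x)" arbitrary: x rule: less_induct)
    case less
    show ?case
    proof (cases "x = y")
      case False
      then obtain d where d: "d \<in> roots x" "d \<notin> roots y"
        using le_roots_psubset[OF less(3) y less(2)] by blast
      note t = canonical_target[OF less(3) y less(2) d]
      have le: "le (step x d (y d)) y" using le_step_iff[OF less(3) y less(2) d(1) t(1)] t(2) by simp
      have "card (roots (step x d (y d))) < card (roots x)"
        unfolding step_roots[OF less(3) d(1) t(1)] using card_Diff1_less[OF finite_roots d(1)] .
      from less(1)[OF this le step_substs[OF less(3) d(1) t(1)]] show ?thesis
        using Dowling_step_of_step[OF less(3) d(1) t(1)] by (rule converse_rtranclp_into_rtranclp[rotated])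
    qed simp
  qed
  then show "(enc x, enc y) \<in> Dowling_order n G S \<phi>"
    using enc_Dowling x y by (simp add: Dowling_order_def)
qed

lemma sub_Dowling_enc:
  assumes x: "x \<in> substs"
  shows "enc x \<in> sub_Dowling n G S T \<phi> \<longleftrightarrow> x \<in> P"
proof -
  have orb: "{X \<in> orbits G S \<phi>. X \<subseteq> S - T} = (\<lambda>s. {s}) ` (S - T)"
  proof -
    have "orbit G \<phi> s = {s}" if "s \<in> S - T" for s
      unfolding orbit_def using trivial[OF _ that] one_closed by force
    moreover have "s \<in> orbit G \<phi> s" if "s \<in> S" for s using orbit_refl[OF that] .
    ultimately show ?thesis unfolding orbits_def by fastforce
  qed
  have cc: "{i \<in> zeros x. snd (enc x) i \<in> {s}} = colour_class x s" for s
    by (auto simp: colour_class_def zeros_def enc_def)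
  have "enc x \<in> sub_Dowling n G S T \<phi> \<longleftrightarrow>
    (\<forall>X\<in>{X \<in> orbits G S \<phi>. X \<subseteq> S - T}. card {i \<in> zeros x. snd (enc x) i \<in> X} \<noteq> 1)"
    using enc_Dowling[OF x] zero_block_enc[OF x] unfolding sub_Dowling_def enc_def by auto
  then show ?thesis unfolding orb using x cc by (simp add: P_def)
qed

lemma sub_Dowling_order_enc: "sub_Dowling_order n G S T \<phi> = map_prod enc enc ` model_order"
proof -
  have sub: "\<exists>x\<in>P. p = enc x" if "p \<in> sub_Dowling n G S T \<phi>" for p
  proof -
    have "p \<in> Dowling n G S" using that by (auto simp: sub_Dowling_def)
    then show ?thesis using enc_surj sub_Dowling_enc that by metis
  qed
  show ?thesis
  proof (intro equalityI subsetI)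
    fix pq assume "pq \<in> sub_Dowling_order n G S T \<phi>"
    then obtain p q where "pq = (p, q)" "(p, q) \<in> Dowling_order n G S \<phi>"
      "p \<in> sub_Dowling n G S T \<phi>" "q \<in> sub_Dowling n G S T \<phi>"
      unfolding sub_Dowling_order_def by blast
    moreover from this obtain x y where "x \<in> P" "y \<in> P" "p = enc x" "q = enc y" using sub by metis
    ultimately have "x \<in> P" "y \<in> P" "pq = (enc x, enc y)" "(enc x, enc y) \<in> Dowling_order n G S \<phi>"
      by auto
    then show "pq \<in> map_prod enc enc ` model_order"
      using Dowling_order_enc[OF P_substs P_substs] by (force simp: model_order_def)
  next
    fix pq assume "pq \<in> map_prod enc enc ` model_order"
    then obtain x y where "x \<in> P" "y \<in> P" "pq = (enc x, enc y)" "le x y" by (auto simp: model_order_def)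
    then show "pq \<in> sub_Dowling_order n G S T \<phi>"
      using Dowling_order_enc[OF P_substs P_substs] sub_Dowling_enc[OF P_substs]
      by (simp add: sub_Dowling_order_def)
  qed
qed

lemma adjoin_top_enc:
  "adjoin_top (sub_Dowling_order n G S T \<phi>) =
   map_prod (map_option enc) (map_option enc) ` adjoin_top model_order"
  unfolding sub_Dowling_order_enc by (rule adjoin_top_map_prod)

theorem EL_shellable_sub_Dowling: "EL_shellable (adjoin_top (sub_Dowling_order n G S T \<phi>))"
proof -
  let ?f = "map_option enc"
  interpret model: local_EL "adjoin_top model_order" top_edge top_rank top_label
    by (rule local_EL_model)
  have inj: "inj_on ?f (Field (adjoin_top model_order))"
    unfolding Field_adjoin_top_model
    using inj_onD[OF enc_inj] P_substs by (fastforce simp: inj_on_def)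
  note im = model.image[OF inj]
  note EL = local_EL.EL_labeling[OF im, folded adjoin_top_enc]
  have po: "Partial_order (adjoin_top (sub_Dowling_order n G S T \<phi>))"
    using EL_labeling_def local_EL.po[OF im] adjoin_top_enc by simp
  have F: "Field (adjoin_top (sub_Dowling_order n G S T \<phi>)) = ?f ` Field (adjoin_top model_order)"
    unfolding adjoin_top_enc by (force simp: Field_def)
  have "bounded_poset (adjoin_top (sub_Dowling_order n G S T \<phi>))"
  proof -
    obtain b t where b: "b \<in> Field (adjoin_top model_order)"
        "\<And>x. x \<in> Field (adjoin_top model_order) \<Longrightarrow> (b, x) \<in> adjoin_top model_order"
      and t: "t \<in> Field (adjoin_top model_order)"
        "\<And>x. x \<in> Field (adjoin_top model_order) \<Longrightarrow> (x, t) \<in> adjoin_top model_order"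
      using bounded_model unfolding bounded_poset_def by blast
    have "\<forall>a\<in>Field (adjoin_top (sub_Dowling_order n G S T \<phi>)).
        (?f b, a) \<in> adjoin_top (sub_Dowling_order n G S T \<phi>) \<and>
        (a, ?f t) \<in> adjoin_top (sub_Dowling_order n G S T \<phi>)"
      unfolding F unfolding adjoin_top_enc using b(2) t(2) by (auto intro: map_prod_imageI)
    then show ?thesis unfolding bounded_poset_def using po F b(1) t(1) by blast
  qed
  then show ?thesis using EL by (rule EL_shellableI)
qed

end

theorem theoremC:
  fixes n :: nat
    and G :: "('g, 'm) monoid_scheme"
    and S T :: "'s set"
    and \<phi> :: "'g \<Rightarrow> 's \<Rightarrow> 's"
  assumes "n \<ge> 2"
    and "group G" and "finite (carrier G)"
    and "finite S" and "card S \<ge> 1"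
    and "group_action G S \<phi>"
    and "T \<subseteq> S" and "\<forall>g\<in>carrier G. \<phi> g ` T \<subseteq> T"
    and "\<forall>g\<in>carrier G. \<forall>s\<in>S - T. \<phi> g s = s"
  shows "EL_shellable (adjoin_top (sub_Dowling_order n G S T \<phi>))"
proof -
  \<comment> \<open>Any injective numbering of the finitely many colours may serve as their order in
    the labels.\<close>
  obtain idx :: "'s \<Rightarrow> nat" where "inj_on idx S"
    using finite_imp_inj_to_nat_seg[OF assms(4)] by blast
  then interpret dowling_model G S \<phi> n T idx
    using assms by (intro dowling_model.intro dowling_model_axioms.intro) auto
  show ?thesis by (rule EL_shellable_sub_Dowling)
qed

end
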